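(* Let $m\geq1$ and let $n_1,\ldots,n_m$ be integers $\geq 2$. Let $\mathfrak{D}$ be an infinite set of positive quadratic discriminants $d$ such that, for every $d\in\mathfrak{D}$: (a) each of $n_1,\ldots,n_m$ is the norm of a reduced principal ideal of $\mathcal{O}_d$; (b) each $n_i$ factors as $n_i=n_i'n_i''$ with natural numbers $n_i',n_i''$ such that (b1) $n_i'$ is coprime to $d$; (b2) $n_i''$ is a squarefree divisor of the fundamental discriminant $d_0$ associated with $d$; (b3) $n_1',\ldots,n_m'$ are pairwise coprime. Then there is a constant $c>0$ such that \[ \log\xi_d\geq c\,(\log\sqrt{d})^{m+1}\quad\text{for all } d\in\mathfrak{D}. \]
   Context: A (quadratic) discriminant is a positive non-square integer $d\equiv 0,1\pmod 4$. Put $\omega_d=\sqrt d/2$ if $d\equiv0\pmod4$ and $\omega_d=(1+\sqrt d)/2$ if $d\equiv1\pmod4$, and $\mathcal{O}_d=\mathbb{Z}[\omega_d]$, an order in $\mathbb{Q}(\sqrt d)$; writing $d=d_0f^2$ with $d_0$ the fundamental discriminant of $\mathbb{Q}(\sqrt d)$, $f$ is the conductor. $\xi_d>1$ is the fundamental unit of $\mathcal{O}_d$ (the unit group is $\{\pm\xi_d^k\}$). The norm of a nonzero ideal $\mathfrak a$ is $N(\mathfrak a)=|\mathcal{O}_d/\mathfrak a|$. Write $[\alpha,\beta]=\alpha\mathbb{Z}+\beta\mathbb{Z}$. A quadratic irrational of discriminant $d$ is $\rho=(b+\sqrt d)/(2a)$ with integers $a>0$, $b$, $4a\mid b^2-d$,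 $\gcd(a,b,(b^2-d)/(4a))=1$; it is reduced if $\rho>1$ and $-1<\rho'<0$, where $\rho'=(b-\sqrt d)/(2a)$. An ideal of $\mathcal{O}_d$ is reduced if it equals $[a,(b+\sqrt d)/2]$ for some reduced quadratic irrational $\rho=(b+\sqrt d)/(2a)$ of discriminant $d$ (its norm is then $a$).
   Formalization: The formal theorem additionally requires each n_i' > 1 in (b); with n_i' = 1 allowed the claim fails, e.g. m=1, n_1=2=1·2, d=4(k²−2) with k≥3 odd, where k²−1+k√(k²−2) is a unit and so log ξ_d = O(log √d). *)

theory Defs
  imports
    Complex_Main
    "HOL-Computational_Algebra.Polynomial"
    "HOL-Computational_Algebra.Squarefree"
    "HOL-Algebra.QuotRing"
begin

definition quad_discriminant :: "int \<Rightarrow> bool" where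
  "quad_discriminant d \<longleftrightarrow> d > 0 \<and> (\<nexists>k. d = k\<^sup>2) \<and> (d mod 4 = 0 \<or> d mod 4 = 1)"

definition quad_omega :: "int \<Rightarrow> real" where
  "quad_omega d = (if d mod 4 = 0 then sqrt (of_int d) / 2 else (1 + sqrt (of_int d)) / 2)"

text \<open>
  The order \<open>\<int>[\<omega>\<^sub>d]\<close>, as a subring of the reals; its elements are the values at
  \<open>\<omega>\<^sub>d\<close> of the polynomials with integer coefficients.
\<close>

definition quad_order :: "int \<Rightarrow> real ring" where
  "quad_order d =
    \<lparr>carrier = range (\<lambda>p :: int poly. poly (map_poly of_int p) (quad_omega d)),
     mult = (*), one = 1, zero = 0, add = (+)\<rparr>"

definition quad_lattice :: "real \<Rightarrow> real \<Rightarrow> real set" where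
  "quad_lattice \<alpha> \<beta> = {of_int x * \<alpha> + of_int y * \<beta> | x y :: int. True}"

text \<open>
  The squarefree part \<open>s\<close> of \<open>d\<close> satisfies \<open>\<rat>(\<surd>s) = \<rat>(\<surd>d)\<close>, and the discriminant of that
  field is \<open>s\<close> or \<open>4 s\<close>.
\<close>

definition fundamental_disc :: "int \<Rightarrow> int" where
  "fundamental_disc d = (let s = squarefree_part d in if s mod 4 = 1 then s else 4 * s)"

definition fundamental_unit :: "int \<Rightarrow> real" where
  "fundamental_unit d =
    (THE \<xi>. \<xi> > 1 \<and> Units (quad_order d) = {s * \<xi> powi k | s k. s \<in> {1, -1}})"

definition ideal_norm :: "int \<Rightarrow> real set \<Rightarrow> nat" where
  "ideal_norm d I = card (carrier (quad_order d Quot I))"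

text \<open>
  Quadratic irrationals \<open>(b + \<surd>d) / (2 a)\<close> are represented by the pair \<open>a\<close>, \<open>b\<close>, which they
  determine uniquely.
\<close>

definition quad_irrational :: "int \<Rightarrow> int \<Rightarrow> int \<Rightarrow> bool" where
  "quad_irrational d a b \<longleftrightarrow>
    a > 0 \<and> 4 * a dvd b\<^sup>2 - d \<and> gcd a (gcd b ((b\<^sup>2 - d) div (4 * a))) = 1"

definition reduced_quad_irrational :: "int \<Rightarrow> int \<Rightarrow> int \<Rightarrow> bool" where
  "reduced_quad_irrational d a b \<longleftrightarrow>
    quad_irrational d a b \<and>
    (of_int b + sqrt (of_int d)) / (2 * of_int a) > 1 \<and>
    -1 < (of_int b - sqrt (of_int d)) / (2 * of_int a) \<and>
    (of_int b - sqrt (of_int d)) / (2 * of_int a) < 0"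

definition reduced_ideal :: "int \<Rightarrow> real set \<Rightarrow> bool" where
  "reduced_ideal d I \<longleftrightarrow>
    ideal I (quad_order d) \<and>
    (\<exists>a b. reduced_quad_irrational d a b \<and>
           I = quad_lattice (of_int a) ((of_int b + sqrt (of_int d)) / 2))"

text \<open>
  Pitfall: in a factorization \<open>n = n' n''\<close> with \<open>n'\<close> coprime to \<open>d\<close> and \<open>n''\<close> a squarefree divisor
  of the fundamental discriminant, a regulator bound of order \<open>(log \<surd>d)\<^sup>2\<close> or higher needs \<open>n' > 1\<close>.
  For \<open>d = 4 (k\<^sup>2 - 2)\<close> with \<open>k \<ge> 3\<close> odd, \<open>k + \<surd>(k\<^sup>2 - 2)\<close> generates a reduced ideal of norm
  \<open>2 = 1 \<cdot> 2\<close>, while \<open>k\<^sup>2 - 1 + k \<surd>(k\<^sup>2 - 2)\<close> is a unit, so that \<open>log \<xi>\<^sub>d = O(log \<surd>d)\<close>.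
\<close>

end

theory Submission
  imports Defs "HOL-Analysis.Kronecker_Approximation_Theorem"
begin

text \<open>
  An element \<open>\<gamma>\<close> of the order with conjugate \<open>\<gamma>'\<close> is placed on the real line at
  \<open>ln \<bar>\<gamma> / \<gamma>'\<bar> / 2\<close>; multiplication by the fundamental unit \<open>\<xi>\<close> is a shift by \<open>R = ln \<xi>\<close>.
  If \<open>\<gamma> \<noteq> \<gamma>'\<close> then \<open>\<bar>\<gamma> - \<gamma>'\<bar> \<ge> \<surd>d\<close>, so that \<open>\<gamma>\<close> of norm at most \<open>\<surd>d\<close> lies at distance at least
  \<open>ln (\<surd>d / 4) / 2\<close> from the origin.

  Let \<open>\<alpha>\<^sub>i\<close> generate a reduced ideal of norm \<open>n\<^sub>i\<close> and let \<open>p\<^sub>i\<close> be a prime divisor of \<open>n\<^sub>i'\<close>. As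
  \<open>\<alpha>\<^sub>i\<close> is primitive and \<open>p\<^sub>i\<close> divides neither \<open>d\<close> nor the other norms, no quotient of two distinct
  monomials in the \<open>\<alpha>\<^sub>i\<close> is a unit times a rational number. Hence the monomials of norm at most
  \<open>d\<^sup>1\<^sup>/\<^sup>4\<close>, of which there are at least a constant times \<open>(ln \<surd>d) ^ m\<close>, occupy points of the circle
  \<open>\<real> / R \<int>\<close> with pairwise distances at least \<open>ln (\<surd>d / 4) / 2\<close>, and this bounds \<open>R\<close> from below.
\<close>

section \<open>Pairs of conjugate elements of the order\<close>

text \<open>With \<open>\<theta> = (d + \<surd>d) / 2\<close> one has \<open>\<int>[\<omega>\<^sub>d] = \<int> + \<int> \<theta>\<close> in both residue classes of \<open>d\<close> modulo 4.\<close>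

definition conj_pairs :: "int \<Rightarrow> (real \<times> real) set" where
  "conj_pairs d = {(of_int u + of_int v * ((of_int d + sqrt (of_int d)) / 2),
                    of_int u + of_int v * ((of_int d - sqrt (of_int d)) / 2)) | u v. True}"

text \<open>As \<xi> > 1, the sign must be 1 and the exponent at least 1. This is half of the
  uniqueness that the description operator in \<open>fundamental_unit\<close> requires.\<close>

lemma powi_sign_generators_le:
  assumes "(\<xi> :: real) > 1" "\<eta> > 1" "\<xi> \<in> {s * \<eta> powi k | s k. s \<in> {1, -1}}"
  shows "\<eta> \<le> \<xi>"
proof -
  obtain s k where sk: "\<xi> = s * \<eta> powi k" "s = 1 \<or> s = -1" using assms by auto
  have pos: "\<eta> powi k > 0" using assms by simp
  hence xi: "\<xi> = \<eta> powi k" using sk assms(1) by (elim disjE) auto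
  hence "k > 0"
    using assms power_int_increasing[of k 0 \<eta>] by (cases "k \<le> 0") auto
  thus ?thesis unfolding xi using power_int_increasing[of 1 k \<eta>] assms by simp
qed

locale quad_disc =
  fixes d :: int
  assumes disc: "quad_discriminant d"
begin

abbreviation E :: "(real \<times> real) set" where "E \<equiv> conj_pairs d"

text \<open>With \<theta> = (d + sqrt d) / 2 this is the norm of \<theta>, so that \<theta>^2 = d
  \<theta> - \<open>q\<close>; the division is exact because a discriminant is 0 or 1 modulo
  4.\<close>

definition q :: int where "q = (d\<^sup>2 - d) div 4"

lemma four_q: "4 * q = d\<^sup>2 - d"
proof -
  have "d mod 4 = 0 \<or> d mod 4 = 1"
    using disc by (simp add: quad_discriminant_def)
  hence "4 dvd d \<or> 4 dvd d - 1" by presburger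
  hence "4 dvd d * (d - 1)" by auto
  thus ?thesis
    unfolding q_def by (simp add: power2_eq_square algebra_simps)
qed

lemma d_gt_1: "d > 1"
proof -
  have "d > 0" "d \<noteq> 1\<^sup>2"
    using disc unfolding quad_discriminant_def by blast+
  thus ?thesis by simp
qed

abbreviation rd :: real where "rd \<equiv> sqrt (of_int d)"

lemma rd_square: "rd * rd = of_int d"
  using d_gt_1 by simp

lemma rd_gt_1: "rd > 1"
  using d_gt_1 by simp

text \<open>Squaring turns a nontrivial relation into x^2 = d y^2, which would make \<open>d\<close>
  a perfect square. Uniqueness of coordinates and of conjugates rests on this.\<close>

lemma rd_lin_indep:
  assumes "of_int x + of_int y * rd = 0"
  shows "x = 0 \<and> y = 0"
proof -
  have "of_int x = - (of_int y * rd)" using assms by simp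
  hence "real_of_int x * of_int x = of_int y * of_int y * (rd * rd)"
    by (simp del: real_sqrt_mult_self)
  hence "real_of_int (x * x) = of_int (y * y * d)"
    using rd_square by simp
  hence eq: "x * x = y * y * d" by linarith
  show ?thesis
  proof (cases "y = 0")
    case True
    thus ?thesis using eq by simp
  next
    case False
    have "y\<^sup>2 dvd x\<^sup>2" using eq by (simp add: power2_eq_square)
    hence "y dvd x" by simp
    then obtain k where "x = y * k" by (elim dvdE)
    with eq False have "d = k\<^sup>2" by (simp add: power2_eq_square)
    thus ?thesis using disc unfolding quad_discriminant_def by blast
  qed
qed

lemma rd_not_Rats: "rd \<notin> \<rat>"
proof
  assume "rd \<in> \<rat>"
  then obtain a b where "b > 0" "rd = of_int a / of_int b"
    by (meson Rats_cases')
  hence "of_int (-a) + of_int b * rd = 0" by simp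
  thus False using rd_lin_indep \<open>b > 0\<close> by blast
qed

lemma E_I: "a = of_int u + of_int v * ((of_int d + rd) / 2) \<Longrightarrow>
    b = of_int u + of_int v * ((of_int d - rd) / 2) \<Longrightarrow> (a, b) \<in> E"
  unfolding conj_pairs_def by blast

lemma E_E:
  assumes "(a, b) \<in> E"
  obtains u v where "a = of_int u + of_int v * ((of_int d + rd) / 2)"
    "b = of_int u + of_int v * ((of_int d - rd) / 2)"
  using assms unfolding conj_pairs_def by blast

lemma coords_unique:
  assumes "of_int u + of_int v * ((of_int d + rd) / 2) = of_int u' + of_int v' * ((of_int d + rd) / 2)"
  shows "u = u' \<and> v = v'"
proof -
  have "of_int (2 * (u - u') + d * (v - v')) + of_int (v - v') * rd = 0"
    using assms by (simp add: field_simps)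
  from rd_lin_indep[OF this] show ?thesis by auto
qed

lemma E_int: "(of_int k, of_int k) \<in> E"
  by (rule E_I[of _ k 0]) auto

lemma E_one: "(1, 1) \<in> E"
  using E_int[of 1] by simp

lemma E_swap:
  assumes "(a, b) \<in> E"
  shows "(b, a) \<in> E"
proof -
  obtain u v where "a = of_int u + of_int v * ((of_int d + rd) / 2)"
    "b = of_int u + of_int v * ((of_int d - rd) / 2)"
    using assms by (elim E_E)
  \<comment> \<open>The conjugate of \<theta> is d - \<theta>.\<close>
  thus ?thesis by (intro E_I[of _ "u + v * d" "- v"]) (auto simp: field_simps)
qed

lemma E_add:
  assumes "(a, b) \<in> E" "(a', b') \<in> E"
  shows "(a + a', b + b') \<in> E"
proof -
  obtain u v where "a = of_int u + of_int v * ((of_int d + rd) / 2)"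
    "b = of_int u + of_int v * ((of_int d - rd) / 2)"
    using assms(1) by (elim E_E)
  moreover obtain u' v' where "a' = of_int u' + of_int v' * ((of_int d + rd) / 2)"
    "b' = of_int u' + of_int v' * ((of_int d - rd) / 2)"
    using assms(2) by (elim E_E)
  ultimately show ?thesis
    by (intro E_I[of _ "u + u'" "v + v'"]) (simp_all add: distrib_right)
qed

text \<open>This comes from \<theta>^2 = d \<theta> - \<open>q\<close>; the sign \<open>s\<close>,
  taken as 1 or -1, treats \<theta> and its conjugate at once.\<close>

lemma theta_mult:
  "(of_int u + of_int v * ((of_int d + s * rd) / 2)) * (of_int u' + of_int v' * ((of_int d + s * rd) / 2)) =
    of_int (u * u' - v * v' * q) + of_int (u * v' + u' * v + v * v' * d) * ((of_int d + s * rd) / 2)"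
  if "s * s = (1 :: real)"
proof -
  have "real_of_int (4 * q) = of_int (d\<^sup>2 - d)" using four_q by simp
  hence q: "4 * real_of_int q = of_int d * of_int d - rd * rd"
    using rd_square by (simp add: power2_eq_square)
  define D where "D = real_of_int d"
  define T where "T = (D + s * rd) / 2"
  have TT: "T * T = D * T - of_int q"
  proof -
    have "4 * (T * T) = D * D + 2 * D * (s * rd) + (s * s) * (rd * rd)"
      unfolding T_def by (simp add: field_simps)
    also have "\<dots> = 4 * (D * T) - 4 * of_int q"
      unfolding q that T_def D_def by (simp add: field_simps)
    finally show ?thesis by simp
  qed
  have "(of_int u + of_int v * T) * (of_int u' + of_int v' * T) =
      of_int u * of_int u' + (of_int u * of_int v' + of_int u' * of_int v) * T
        + of_int v * of_int v' * (T * T)"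
    by (simp add: algebra_simps)
  also have "\<dots> = of_int (u * u' - v * v' * q) + of_int (u * v' + u' * v + v * v' * d) * T"
    unfolding TT by (simp add: algebra_simps D_def)
  finally show ?thesis unfolding T_def D_def .
qed

lemma E_mult:
  assumes "(a, b) \<in> E" "(a', b') \<in> E"
  shows "(a * a', b * b') \<in> E"
proof -
  obtain u v where uv: "a = of_int u + of_int v * ((of_int d + rd) / 2)"
    "b = of_int u + of_int v * ((of_int d - rd) / 2)"
    using assms(1) by (elim E_E)
  obtain u' v' where uv': "a' = of_int u' + of_int v' * ((of_int d + rd) / 2)"
    "b' = of_int u' + of_int v' * ((of_int d - rd) / 2)"
    using assms(2) by (elim E_E)
  show ?thesis
    unfolding uv uv' using theta_mult[of 1 u v u' v'] theta_mult[of "-1" u v u' v']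
    by (intro E_I[of _ "u * u' - v * v' * q" "u * v' + u' * v + v * v' * d"]) simp_all
qed

lemma E_minus: "(a, b) \<in> E \<Longrightarrow> (- a, - b) \<in> E"
  using E_mult[OF E_int[of "-1"]] by simp

lemma E_power: "(a, b) \<in> E \<Longrightarrow> (a ^ k, b ^ k) \<in> E"
  by (induction k) (auto intro: E_mult E_one)

lemma E_prod:
  assumes "\<And>i. i \<in> S \<Longrightarrow> (f i, g i) \<in> E"
  shows "(prod f S, prod g S) \<in> E"
  using assms by (induction S rule: infinite_finite_induct) (auto intro: E_mult E_one)

text \<open>Uniqueness of coordinates makes \<open>E\<close> the graph of conjugation, so an
  identity between first components carries over to the second ones.\<close>

lemma E_fst_unique: "(a, b) \<in> E \<Longrightarrow> (a, c) \<in> E \<Longrightarrow> b = c"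
  by (elim E_E) (use coords_unique in metis)

text \<open>In these coordinates the norm is a binary quadratic form of discriminant d^2 - 4
  \<open>q\<close> = d.\<close>

lemma E_norm_coords:
  assumes "a = of_int u + of_int v * ((of_int d + rd) / 2)"
    "b = of_int u + of_int v * ((of_int d - rd) / 2)"
  shows "a * b = of_int (u\<^sup>2 + d * u * v + q * v\<^sup>2)"
proof -
  have "4 * real_of_int q = of_int d * of_int d - rd * rd"
    using arg_cong[OF four_q, of real_of_int] rd_square by (simp add: power2_eq_square)
  have "4 * (a * b) = 4 * of_int u * of_int u + 4 * of_int u * of_int v * of_int d
      + of_int v * of_int v * (of_int d * of_int d - rd * rd)"
    unfolding assms by (simp add: field_simps)
  also have "\<dots> = 4 * of_int (u\<^sup>2 + d * u * v + q * v\<^sup>2)"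
    unfolding \<open>4 * real_of_int q = _\<close>[symmetric] by (simp add: power2_eq_square algebra_simps)
  finally show ?thesis by simp
qed

lemma E_norm_int: assumes "(a, b) \<in> E" shows "a * b \<in> \<int>"
  using assms by (elim E_E) (simp only: E_norm_coords Ints_of_int)

text \<open>The difference is v sqrt d with a nonzero integer v. The separation of points on the
  circle comes from this gap.\<close>

lemma E_diff:
  assumes "(a, b) \<in> E" "a \<noteq> b"
  shows "\<bar>a - b\<bar> \<ge> rd"
proof -
  obtain u v where uv: "a = of_int u + of_int v * ((of_int d + rd) / 2)"
    "b = of_int u + of_int v * ((of_int d - rd) / 2)"
    using assms(1) by (elim E_E)
  have eq: "a - b = of_int v * rd" unfolding uv by (simp add: field_simps)
  hence "v \<noteq> 0" using assms(2) by auto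
  hence "\<bar>real_of_int v\<bar> \<ge> 1" by linarith
  thus ?thesis using eq rd_gt_1 by (simp add: abs_mult)
qed

lemma E_eq_int:
  assumes "(a, a) \<in> E"
  shows "a \<in> \<int>"
proof -
  obtain u v where uv: "a = of_int u + of_int v * ((of_int d + rd) / 2)"
    "a = of_int u + of_int v * ((of_int d - rd) / 2)"
    using assms by (elim E_E)
  hence "of_int v * rd = 0" by (simp add: field_simps)
  hence "v = 0" using rd_gt_1 by auto
  thus ?thesis using uv by simp
qed

lemma E_zero_iff:
  assumes "(a, b) \<in> E"
  shows "a = 0 \<longleftrightarrow> b = 0"
  using assms E_fst_unique[of 0 b 0] E_fst_unique[of 0 a 0] E_int[of 0] E_swap by auto

section \<open>The order as a commutative ring\<close>

lemma omega_theta: "\<exists>k. quad_omega d = of_int k + (of_int d + rd) / 2"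
proof (cases "d mod 4 = 0")
  case True
  hence "d = 2 * (d div 2)" by presburger
  hence "real_of_int d = 2 * of_int (d div 2)" by (metis of_int_mult of_int_numeral)
  thus ?thesis using True unfolding quad_omega_def
    by (intro exI[of _ "- (d div 2)"]) (simp add: field_simps)
next
  case False
  hence "d mod 4 = 1" using disc by (simp add: quad_discriminant_def)
  hence "d = 2 * (d div 2) + 1" by presburger
  hence "real_of_int d = 2 * of_int (d div 2) + 1" by (metis of_int_1 of_int_add of_int_mult of_int_numeral)
  thus ?thesis using False unfolding quad_omega_def
    by (intro exI[of _ "- (d div 2)"]) (simp add: field_simps)
qed

text \<open>\<open>quad_omega d\<close> and \<theta> differ by an integer. Horner's scheme therefore
  keeps the values of polynomials inside \<open>E\<close>, and linear polynomials already give every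
  element.\<close>

lemma carrier_eq: "carrier (quad_order d) = fst ` E"
proof (intro equalityI subsetI)
  obtain k where k: "quad_omega d = of_int k + (of_int d + rd) / 2"
    using omega_theta by blast
  have om: "(quad_omega d, of_int k + (of_int d - rd) / 2) \<in> E"
    unfolding k by (rule E_I[of _ k 1]) auto
  have *: "\<exists>b. (poly (map_poly of_int p) (quad_omega d), b) \<in> E" for p :: "int poly"
  proof (induction p)
    case 0
    show ?case using E_int[of 0] by auto
  next
    case (pCons c p)
    then obtain b where "(poly (map_poly of_int p) (quad_omega d), b) \<in> E" by blast
    from E_add[OF E_int[of c] E_mult[OF om this]] show ?case
      by (auto simp: map_poly_pCons)
  qed
  fix x assume "x \<in> carrier (quad_order d)"
  thus "x \<in> fst ` E" using * by (force simp: quad_order_def)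
next
  obtain k where k: "quad_omega d = of_int k + (of_int d + rd) / 2"
    using omega_theta by blast
  fix x assume "x \<in> fst ` E"
  then obtain b where "(x, b) \<in> E" by auto
  then obtain u v where "x = of_int u + of_int v * ((of_int d + rd) / 2)" by (elim E_E)
  hence "x = poly (map_poly of_int [:u - k * v, v:]) (quad_omega d)"
    unfolding k by (simp add: map_poly_pCons algebra_simps)
  thus "x \<in> carrier (quad_order d)" by (simp add: quad_order_def)
qed

lemma in_carrier: "x \<in> carrier (quad_order d) \<longleftrightarrow> (\<exists>b. (x, b) \<in> E)"
  unfolding carrier_eq by force

lemma order_ops [simp]:
  "mult (quad_order d) = (*)" "one (quad_order d) = 1" "zero (quad_order d) = 0" "add (quad_order d) = (+)"
  by (simp_all add: quad_order_def)

lemma cring_order: "cring (quad_order d)"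
proof (rule cringI)
  show "abelian_group (quad_order d)"
  proof (rule abelian_groupI)
    fix x assume "x \<in> carrier (quad_order d)"
    then obtain b where "(x, b) \<in> E" unfolding in_carrier by blast
    from E_minus[OF this] show "\<exists>y\<in>carrier (quad_order d). y \<oplus>\<^bsub>quad_order d\<^esub> x = \<zero>\<^bsub>quad_order d\<^esub>"
      by (intro bexI[of _ "- x"]) (auto simp: in_carrier)
  qed (use E_int[of 0] in \<open>auto simp: in_carrier intro: E_add\<close>)
  show "comm_monoid (quad_order d)"
    by (rule comm_monoidI) (use E_one in \<open>auto simp: in_carrier intro: E_mult\<close>)
qed (auto simp: algebra_simps)

section \<open>Units\<close>

text \<open>In h^2 - d k^2 = (h - k sqrt d) (h + k sqrt d) the first factor is below 1 / k in
  absolute value and the second is at most 2 k sqrt d + k.\<close>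

lemma pell_bound:
  assumes "(h, k) \<in> approx_set rd"
  shows "h > 0" "k > 0" "\<bar>h * h - d * k * k\<bar> \<le> \<lceil>2 * rd + 1\<rceil>" "h * h - d * k * k \<noteq> 0"
proof -
  have k: "k > 0" and app: "\<bar>rd - of_int h / of_int k\<bar> < 1 / (of_int k)\<^sup>2"
    using assms by (auto simp: approx_set_def)
  show "k > 0" by fact
  have k1: "real_of_int k \<ge> 1" using k by simp
  have "of_int k * rd - of_int h = of_int k * (rd - of_int h / of_int k)"
    using k by (simp add: field_simps)
  hence "\<bar>of_int k * rd - of_int h\<bar> = of_int k * \<bar>rd - of_int h / of_int k\<bar>"
    using k by (simp only: abs_mult)
  also have "\<dots> < of_int k * (1 / (of_int k)\<^sup>2)"
    using app k by (intro mult_strict_left_mono) auto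
  also have "\<dots> = 1 / of_int k" using k by (simp add: power2_eq_square)
  finally have app': "\<bar>of_int k * rd - of_int h\<bar> < 1 / of_int k" .
  also have "1 / of_int k \<le> (1 :: real)" using k1 by simp
  finally have app1: "\<bar>of_int k * rd - of_int h\<bar> < 1" .
  have krd: "of_int k * rd > 1"
    using mult_less_le_imp_less[of 1 rd 1 "of_int k"] rd_gt_1 k1 by (simp add: mult.commute)
  have "real_of_int h > 0" using app1 krd by linarith
  thus "h > 0" by simp
  have fact: "real_of_int (h * h - d * k * k) = (of_int h - of_int k * rd) * (of_int h + of_int k * rd)"
    using rd_square by (simp add: algebra_simps)
  have "\<bar>real_of_int (h * h - d * k * k)\<bar> = \<bar>of_int k * rd - of_int h\<bar> * \<bar>of_int h + of_int k * rd\<bar>"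
    unfolding fact abs_mult by (simp add: abs_minus_commute)
  also have "\<dots> \<le> (1 / of_int k) * \<bar>of_int h + of_int k * rd\<bar>"
    using app' by (intro mult_right_mono) auto
  also have "\<dots> \<le> (1 / of_int k) * (2 * of_int k * rd + of_int k)"
    using app1 krd \<open>real_of_int h > 0\<close> k1 by (intro mult_left_mono) (auto simp: abs_le_iff)
  also have "\<dots> = 2 * rd + 1" using k by (simp add: field_simps)
  finally show "\<bar>h * h - d * k * k\<bar> \<le> \<lceil>2 * rd + 1\<rceil>" by linarith
  show "h * h - d * k * k \<noteq> 0"
  proof
    assume "h * h - d * k * k = 0"
    hence "(of_int h - of_int k * rd) * (of_int h + of_int k * rd) = 0"
      using fact by simp
    hence "of_int h + of_int k * rd = 0 \<or> of_int h + of_int (- k) * rd = 0" by auto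
    thus False using rd_lin_indep k by (metis neg_0_equal_iff_equal less_irrefl)
  qed
qed

text \<open>Dirichlet's argument: among infinitely many good approximations two share their norm n
  and their residues modulo n, and the quotient of the corresponding numbers h + k sqrt d yields a
  solution.\<close>

lemma pell_solution: "\<exists>x y. x * x - d * y * y = 1 \<and> y \<noteq> 0"
proof -
  define A where "A = approx_set rd"
  define C where "C = \<lceil>2 * rd + 1\<rceil>"
  define N where "N = (\<lambda>(h, k). h * h - d * k * k)"
  define f where "f = (\<lambda>z. (N z, fst z mod N z, snd z mod N z))"
  have "infinite A"
    unfolding A_def using rational_iff_finite_approx_set rd_not_Rats by blast
  moreover have "f ` A \<subseteq> {-C..C} \<times> {-C..C} \<times> {-C..C}"
  proof -
    have "f z \<in> {-C..C} \<times> {-C..C} \<times> {-C..C}" if "z \<in> A" for z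
    proof -
      obtain h k where z: "z = (h, k)" by fastforce
      have "N z \<noteq> 0" "\<bar>N z\<bar> \<le> C"
        using pell_bound(3,4)[of h k] that unfolding z A_def C_def N_def by auto
      moreover from this have "\<bar>h mod N z\<bar> \<le> C" "\<bar>k mod N z\<bar> \<le> C"
        using abs_mod_less[of "N z" h] abs_mod_less[of "N z" k] by linarith+
      ultimately show ?thesis unfolding f_def z by (auto simp: abs_le_iff)
    qed
    thus ?thesis by blast
  qed
  hence "finite (f ` A)" by (rule finite_subset) auto
  ultimately obtain z0 where z0: "z0 \<in> A" "infinite {z \<in> A. f z = f z0}"
    using pigeonhole_infinite by blast
  hence "infinite ({z \<in> A. f z = f z0} - {z0})" by simp
  then obtain z1 where z1: "z1 \<in> A" "f z1 = f z0" "z1 \<noteq> z0"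
    using infinite_imp_nonempty by blast
  obtain h k where z0': "z0 = (h, k)" by fastforce
  obtain h' k' where z1': "z1 = (h', k')" by fastforce
  define n where "n = N z0"
  have n: "n = h * h - d * k * k" "n = h' * h' - d * k' * k'" and n0: "n \<noteq> 0"
    and pos: "h > 0" "k > 0" "h' > 0" "k' > 0"
    and cong: "n dvd h' - h" "n dvd k' - k"
    using z0 z1 pell_bound[of h k] pell_bound[of h' k'] unfolding z0' z1' n_def A_def f_def N_def
    by (auto simp: mod_eq_dvd_iff)
  \<comment> \<open>Both coordinates of (h + k sqrt d) (h' - k' sqrt d) are divisible by n; dividing
    by n gives x + y sqrt d of norm 1.\<close>
  have "h * h' - d * k * k' = h * (h' - h) - d * k * (k' - k) + n"
    unfolding n(1) by (simp add: algebra_simps)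
  hence "n dvd h * h' - d * k * k'" using cong by simp
  then obtain x where x: "h * h' - d * k * k' = n * x" by (elim dvdE)
  have "h' * k - h * k' = k * (h' - h) - h * (k' - k)" by (simp add: algebra_simps)
  hence "n dvd h' * k - h * k'" using cong by simp
  then obtain y where y: "h' * k - h * k' = n * y" by (elim dvdE)
  have "n * n * (x * x - d * y * y) = (n * x) * (n * x) - d * (n * y) * (n * y)"
    by (simp add: algebra_simps)
  also have "\<dots> = (h * h - d * k * k) * (h' * h' - d * k' * k')"
    unfolding x[symmetric] y[symmetric] by (simp add: algebra_simps)
  finally have "x * x - d * y * y = 1" using n n0 by simp
  moreover have "y \<noteq> 0"
  proof
    \<comment> \<open>Proportional pairs with positive entries and equal norm coincide.\<close>
    assume "y = 0"
    hence eq: "h' * k = h * k'" using y by simp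
    have "k' * k' * n = (h * k') * (h * k') - d * (k * k') * (k * k')"
      unfolding n(1) by (simp add: algebra_simps)
    also have "\<dots> = k * k * n"
      unfolding eq[symmetric] n(2) by (simp add: algebra_simps)
    finally have "k'\<^sup>2 = k\<^sup>2" using n0 by (simp add: power2_eq_square)
    hence "k' = k" using pos by (simp add: power2_eq_iff)
    with eq pos have "h' = h" by simp
    with \<open>k' = k\<close> z1 show False by (simp add: z0' z1')
  qed
  ultimately show ?thesis by blast
qed

text \<open>\<open>Units_eq\<close> identifies this set with the unit group of the order.\<close>

definition U :: "real set" where
  "U = {x. \<exists>b. (x, b) \<in> E \<and> \<bar>x * b\<bar> = 1}"

lemma U_nonzero: "x \<in> U \<Longrightarrow> x \<noteq> 0"
  by (auto simp: U_def)

lemma U_mult: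
  assumes "x \<in> U" "y \<in> U"
  shows "x * y \<in> U"
proof -
  obtain b c where "(x, b) \<in> E" "\<bar>x * b\<bar> = 1" "(y, c) \<in> E" "\<bar>y * c\<bar> = 1"
    using assms by (auto simp: U_def)
  moreover have "\<bar>x * y * (b * c)\<bar> = \<bar>x * b\<bar> * \<bar>y * c\<bar>" by (simp add: abs_mult)
  ultimately show ?thesis unfolding U_def using E_mult by force
qed

lemma U_minus: "x \<in> U \<Longrightarrow> - x \<in> U"
  unfolding U_def using E_minus by fastforce

lemma U_one: "1 \<in> U"
  unfolding U_def using E_one by force

text \<open>Up to sign the inverse is the conjugate.\<close>

lemma U_inverse:
  assumes "x \<in> U"
  shows "inverse x \<in> U"
proof -
  obtain b where b: "(x, b) \<in> E" "\<bar>x * b\<bar> = 1" using assms by (auto simp: U_def)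
  have "b \<in> U" using b E_swap[OF b(1)] unfolding U_def by (auto simp: mult.commute)
  moreover have "x * b = 1 \<or> x * b = - 1" using b(2) by linarith
  hence "inverse x = b \<or> inverse x = - b"
    using U_nonzero[OF assms] by (auto simp: field_simps)
  ultimately show ?thesis using U_minus by auto
qed

lemma U_powi: "x \<in> U \<Longrightarrow> x powi k \<in> U"
proof -
  assume x: "x \<in> U"
  have *: "y ^ n \<in> U" if "y \<in> U" for y n
    using that by (induction n) (auto intro: U_one U_mult)
  show ?thesis unfolding power_int_def using *[OF x] *[OF U_inverse[OF x]] by simp
qed

text \<open>If x y = 1, the conjugates also have product 1, so the integer norms of x and y multiply
  to 1.\<close>

lemma Units_eq: "Units (quad_order d) = U"
proof (intro equalityI subsetI)
  fix x assume "x \<in> Units (quad_order d)"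
  then obtain y where "x \<in> carrier (quad_order d)" "y \<in> carrier (quad_order d)" "x * y = 1"
    unfolding Units_def by auto
  then obtain b c where bc: "(x, b) \<in> E" "(y, c) \<in> E" "x * y = 1"
    unfolding in_carrier by blast
  have "b * c = 1" using E_mult[OF bc(1,2)] E_one E_fst_unique bc(3) by metis
  obtain i j where ij: "x * b = of_int i" "y * c = of_int j"
    using E_norm_int[OF bc(1)] E_norm_int[OF bc(2)] by (metis Ints_cases)
  have "real_of_int (i * j) = (x * y) * (b * c)" using ij by (simp add: algebra_simps)
  hence "real_of_int (i * j) = 1" using bc(3) \<open>b * c = 1\<close> by simp
  hence "i * j = 1" by (simp only: of_int_eq_1_iff)
  hence "\<bar>i\<bar> = 1" by (metis abs_zmult_eq_1 abs_1)
  hence "\<bar>x * b\<bar> = 1" unfolding ij by simp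
  thus "x \<in> U" using bc(1) by (auto simp: U_def)
next
  fix x assume x: "x \<in> U"
  have "x \<in> carrier (quad_order d)" "inverse x \<in> carrier (quad_order d)"
    using x U_inverse[OF x] unfolding in_carrier U_def by auto
  moreover have "x * inverse x = 1" "inverse x * x = 1" using U_nonzero[OF x] by auto
  ultimately show "x \<in> Units (quad_order d)"
    unfolding Units_def by auto
qed

text \<open>A unit above 1 has a conjugate of absolute value at most 1, so a bound on the unit
  bounds both integer coordinates; \<open>M\<close> covers the two bounds.\<close>

lemma finite_units_le: "finite {x \<in> U. 1 < x \<and> x \<le> B}"
proof -
  define M where "M = \<lceil>(B + 1) * (1 + of_int d)\<rceil>"
  have "{x \<in> U. 1 < x \<and> x \<le> B} \<subseteq>
      (\<lambda>(u, v). of_int u + of_int v * ((of_int d + rd) / 2)) ` ({-M..M} \<times> {-M..M})"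
  proof
    fix x assume "x \<in> {x \<in> U. 1 < x \<and> x \<le> B}"
    then obtain b where b: "(x, b) \<in> E" "\<bar>x * b\<bar> = 1" "1 < x" "x \<le> B" by (auto simp: U_def)
    then obtain u v where uv: "x = of_int u + of_int v * ((of_int d + rd) / 2)"
      "b = of_int u + of_int v * ((of_int d - rd) / 2)" by (elim E_E)
    have "\<bar>b\<bar> \<le> 1"
    proof (rule ccontr)
      assume "\<not> \<bar>b\<bar> \<le> 1"
      hence "1 * 1 < \<bar>x\<bar> * \<bar>b\<bar>" using b(3) by (intro mult_strict_mono) auto
      thus False using b(2) by (simp add: abs_mult)
    qed
    have "of_int v * rd = x - b" unfolding uv by (simp add: field_simps)
    hence "\<bar>of_int v * rd\<bar> \<le> B + 1"
      using \<open>\<bar>b\<bar> \<le> 1\<close> b(3,4) by linarith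
    hence "\<bar>real_of_int v\<bar> * rd \<le> B + 1"
      using d_gt_1 by (simp add: abs_mult)
    moreover have "\<bar>real_of_int v\<bar> * 1 \<le> \<bar>real_of_int v\<bar> * rd"
      using rd_gt_1 by (intro mult_left_mono) auto
    ultimately have v: "\<bar>real_of_int v\<bar> \<le> B + 1" by simp
    have "2 * real_of_int u = x + b - of_int d * of_int v" unfolding uv by (simp add: field_simps)
    moreover have "\<bar>of_int d * real_of_int v\<bar> \<le> of_int d * (B + 1)"
      using v d_gt_1 by (simp add: abs_mult)
    ultimately have u: "\<bar>real_of_int u\<bar> \<le> (B + 1) + of_int d * (B + 1)"
      using \<open>\<bar>b\<bar> \<le> 1\<close> b(3,4) by linarith
    have "of_int d * (B + 1) \<ge> 0" using b(3,4) d_gt_1 by simp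
    with u v have "\<bar>real_of_int u\<bar> \<le> (B + 1) * (1 + of_int d)" "\<bar>real_of_int v\<bar> \<le> (B + 1) * (1 + of_int d)"
      by (simp_all add: algebra_simps)
    hence "\<bar>u\<bar> \<le> M" "\<bar>v\<bar> \<le> M" unfolding M_def by linarith+
    thus "x \<in> (\<lambda>(u, v). of_int u + of_int v * ((of_int d + rd) / 2)) ` ({-M..M} \<times> {-M..M})"
      unfolding uv(1) by (intro image_eqI[of _ _ "(u, v)"]) (auto simp: abs_le_iff)
  qed
  thus ?thesis by (rule finite_subset) auto
qed

lemma exists_unit_gt_1: "\<exists>x\<in>U. x > 1"
proof -
  obtain x y where xy: "x * x - d * y * y = 1" "y \<noteq> 0" using pell_solution by blast
  \<comment> \<open>The absolute values ensure \<open>a\<close> > 1; the coordinates below come from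
    sqrt d = 2 \<theta> - d.\<close>
  define a b where "a = of_int \<bar>x\<bar> + of_int \<bar>y\<bar> * rd" and "b = of_int \<bar>x\<bar> - of_int \<bar>y\<bar> * rd"
  have "(a, b) \<in> E"
    unfolding a_def b_def
    by (rule E_I[of _ "\<bar>x\<bar> - \<bar>y\<bar> * d" "2 * \<bar>y\<bar>"]) (simp_all add: field_simps)
  moreover have "a * b = of_int (\<bar>x\<bar> * \<bar>x\<bar> - d * (\<bar>y\<bar> * \<bar>y\<bar>))"
    using rd_square unfolding a_def b_def by (simp add: algebra_simps)
  moreover have "\<bar>x\<bar> * \<bar>x\<bar> - d * (\<bar>y\<bar> * \<bar>y\<bar>) = 1" using xy(1) by (simp add: mult.assoc)
  ultimately have "(a, b) \<in> E" "a * b = 1" by (metis of_int_1)+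
  moreover have "real_of_int \<bar>y\<bar> \<ge> 1" using xy(2) by linarith
  hence "1 * 1 < rd * real_of_int \<bar>y\<bar>" using rd_gt_1 by (intro mult_less_le_imp_less) auto
  hence "a > 1" unfolding a_def by (simp add: mult.commute)
  ultimately show ?thesis unfolding U_def by force
qed

text \<open>Finiteness of bounded sets of units gives a least unit above 1, and it generates all
  units up to sign. Hence the description operator in the definition denotes it.\<close>

lemma fundamental_unit:
  "fundamental_unit d > 1" "fundamental_unit d \<in> U"
proof -
  obtain x0 where x0: "x0 \<in> U" "x0 > 1" using exists_unit_gt_1 by blast
  define F where "F = {x \<in> U. 1 < x \<and> x \<le> x0}"
  define \<xi> where "\<xi> = Min F"
  have F: "finite F" "F \<noteq> {}" unfolding F_def using finite_units_le x0 by auto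
  hence "\<xi> \<in> F" unfolding \<xi>_def by (rule Min_in)
  hence xi: "\<xi> \<in> U" "\<xi> > 1" by (auto simp: F_def)
  have min: "\<xi> \<le> x" if "x \<in> U" "x > 1" for x
    using that F \<open>\<xi> \<in> F\<close> unfolding \<xi>_def F_def by (cases "x \<le> x0") (auto intro: Min_le order_trans)
  have gen_pos: "\<exists>k. x = \<xi> powi k" if x: "x \<in> U" "x > 0" for x
  proof -
    \<comment> \<open>With this exponent the unit \<open>y\<close> lies in [1, \<xi>), so minimality
      forces \<open>y\<close> = 1.\<close>
    define k where "k = \<lfloor>ln x / ln \<xi>\<rfloor>"
    define y where "y = x * \<xi> powi (- k)"
    have lnxi: "ln \<xi> > 0" using xi by simp
    have "y \<in> U" unfolding y_def using x xi by (intro U_mult U_powi)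
    have y_eq: "y = exp (ln x - of_int k * ln \<xi>)"
      using x xi powr_real_of_int'[of \<xi> "- k"] unfolding y_def
      by (simp add: powr_def exp_diff exp_minus field_simps)
    have "of_int k \<le> ln x / ln \<xi>" "ln x / ln \<xi> < of_int k + 1" unfolding k_def by linarith+
    hence "of_int k * ln \<xi> \<le> ln x" "ln x < (of_int k + 1) * ln \<xi>"
      using lnxi by (simp_all add: field_simps)
    hence "0 \<le> ln x - of_int k * ln \<xi>" "ln x - of_int k * ln \<xi> < ln \<xi>" by (simp_all add: algebra_simps)
    hence "1 \<le> y" "y < \<xi>" unfolding y_eq using xi
      by (auto simp: exp_less_cancel_iff[of _ "ln \<xi>", symmetric] simp del: exp_less_cancel_iff)
    with min[OF \<open>y \<in> U\<close>] have "y = 1" by force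
    hence "x = \<xi> powi k" unfolding y_def power_int_minus using xi by (simp add: field_simps)
    thus ?thesis by blast
  qed
  have gen: "U = {s * \<xi> powi k | s k. s \<in> {1, -1}}"
  proof (intro equalityI subsetI)
    fix x assume x: "x \<in> U"
    show "x \<in> {s * \<xi> powi k | s k. s \<in> {1, -1}}"
    proof (cases "x > 0")
      case True
      then obtain k where "x = 1 * \<xi> powi k" using gen_pos[OF x] by auto
      thus ?thesis by blast
    next
      case False
      hence "- x > 0" using U_nonzero[OF x] by linarith
      then obtain k where "- x = \<xi> powi k" using gen_pos[OF U_minus[OF x]] by auto
      hence "x = - 1 * \<xi> powi k" by simp
      thus ?thesis by blast
    qed
  next
    fix x assume "x \<in> {s * \<xi> powi k | s k. s \<in> {1, -1}}"
    thus "x \<in> U" using U_powi[OF xi(1)] U_minus by auto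
  qed
  have "fundamental_unit d = \<xi>"
    unfolding fundamental_unit_def Units_eq
  proof (rule the_equality)
    show "\<xi> > 1 \<and> U = {s * \<xi> powi k | s k. s \<in> {1, -1}}" using xi gen by blast
    fix \<eta> assume eta: "\<eta> > 1 \<and> U = {s * \<eta> powi k | s k. s \<in> {1, -1}}"
    have "\<eta> = 1 * \<eta> powi 1" by simp
    hence "\<eta> \<in> U" using eta by blast
    \<comment> \<open>This holds because \<xi> is a signed power of \<eta>; the reverse inequality
      is the minimality of \<xi>.\<close>
    have "\<eta> \<le> \<xi>" using powi_sign_generators_le[of \<xi> \<eta>] eta xi by blast
    thus "\<eta> = \<xi>" using min[OF \<open>\<eta> \<in> U\<close>] eta by simp
  qed
  thus "fundamental_unit d > 1" "fundamental_unit d \<in> U" using xi by simp_all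
qed

section \<open>Generators of reduced principal ideals\<close>

text \<open>The divisibility condition gives b and d the same parity, and w = (b - d) / 2. The
  factor \<open>of_int 1\<close> keeps the shape that \<open>E_I\<close> and
  \<open>coords_unique\<close> expect.\<close>

lemma quad_irrational_theta:
  assumes "quad_irrational d a b"
  obtains w where "(of_int b + rd) / 2 = of_int w + of_int 1 * ((of_int d + rd) / 2)"
    "(of_int b - rd) / 2 = of_int w + of_int 1 * ((of_int d - rd) / 2)"
proof -
  have "4 * a dvd b\<^sup>2 - d" using assms by (simp add: quad_irrational_def)
  hence "2 dvd b\<^sup>2 - d" using dvd_trans[of 2 "4 * a" "b\<^sup>2 - d"] by simp
  hence "even (b - d)" by simp
  then obtain w where "b - d = 2 * w" by (elim dvdE)
  hence "b = d + 2 * w" by simp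
  thus ?thesis by (intro that[of w]) (simp_all add: field_simps)
qed

text \<open>Since (b + sqrt d) / 2 = w + \<theta>, membership of u + v \<theta> in the lattice is
  the congruence of u and v w modulo a; hence 0, ..., a - 1 represent the cosets.\<close>

lemma ideal_norm_lattice:
  assumes "quad_irrational d a b" and I: "I = quad_lattice (of_int a) ((of_int b + rd) / 2)"
  shows "ideal_norm d I = nat a"
proof -
  have a: "a > 0" using assms by (simp add: quad_irrational_def)
  obtain w where w: "(of_int b + rd) / 2 = of_int w + of_int 1 * ((of_int d + rd) / 2)"
    using quad_irrational_theta[OF assms(1)] by metis
  have memI: "of_int u + of_int v * ((of_int d + rd) / 2) \<in> I \<longleftrightarrow> a dvd u - v * w" for u v
  proof
    assume "of_int u + of_int v * ((of_int d + rd) / 2) \<in> I"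
    then obtain x y where "of_int u + of_int v * ((of_int d + rd) / 2) =
        of_int x * of_int a + of_int y * ((of_int b + rd) / 2)"
      unfolding I quad_lattice_def by blast
    also have "\<dots> = of_int (x * a + y * w) + of_int y * ((of_int d + rd) / 2)"
      unfolding w by (simp add: algebra_simps)
    finally have "u = x * a + y * w" "v = y" using coords_unique by blast+
    thus "a dvd u - v * w" by simp
  next
    assume "a dvd u - v * w"
    then obtain x where "u - v * w = a * x" by (elim dvdE)
    hence u: "u = a * x + v * w" by simp
    have "of_int u + of_int v * ((of_int d + rd) / 2) =
        of_int x * of_int a + of_int v * ((of_int b + rd) / 2)"
      unfolding w u by (simp add: algebra_simps)
    thus "of_int u + of_int v * ((of_int d + rd) / 2) \<in> I"
      unfolding I quad_lattice_def by blast
  qed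
  have I_diff: "x - y \<in> I" if "x \<in> I" "y \<in> I" for x y
  proof -
    obtain x1 x2 where "x = of_int x1 * of_int a + of_int x2 * ((of_int b + rd) / 2)"
      using \<open>x \<in> I\<close> unfolding I quad_lattice_def by blast
    moreover obtain y1 y2 where "y = of_int y1 * of_int a + of_int y2 * ((of_int b + rd) / 2)"
      using \<open>y \<in> I\<close> unfolding I quad_lattice_def by blast
    ultimately have "x - y = of_int (x1 - y1) * of_int a + of_int (x2 - y2) * ((of_int b + rd) / 2)"
      by (simp add: left_diff_distrib)
    thus ?thesis unfolding I quad_lattice_def by blast
  qed
  have zero: "0 \<in> I" using memI[of 0 0] by simp
  have coset: "I +>\<^bsub>quad_order d\<^esub> x = {y. y - x \<in> I}" for x
    by (force simp: a_r_coset_def')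
  have coset_eq: "I +>\<^bsub>quad_order d\<^esub> x = I +>\<^bsub>quad_order d\<^esub> y \<longleftrightarrow> x - y \<in> I" for x y
  proof
    assume "I +>\<^bsub>quad_order d\<^esub> x = I +>\<^bsub>quad_order d\<^esub> y"
    moreover have "x \<in> I +>\<^bsub>quad_order d\<^esub> x" using zero by (simp add: coset)
    ultimately show "x - y \<in> I" by (auto simp: coset)
  next
    assume *: "x - y \<in> I"
    have "z - x \<in> I \<longleftrightarrow> z - y \<in> I" for z
    proof
      assume "z - x \<in> I"
      from I_diff[OF this I_diff[OF zero *]] show "z - y \<in> I" by simp
    next
      assume "z - y \<in> I"
      from I_diff[OF this *] show "z - x \<in> I" by simp
    qed
    thus "I +>\<^bsub>quad_order d\<^esub> x = I +>\<^bsub>quad_order d\<^esub> y" by (simp add: coset)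
  qed
  have "bij_betw (\<lambda>k. I +>\<^bsub>quad_order d\<^esub> of_int k) {0..<a} (carrier (quad_order d Quot I))"
    unfolding bij_betw_def
  proof
    show "inj_on (\<lambda>k. I +>\<^bsub>quad_order d\<^esub> of_int k) {0..<a}"
    proof (rule inj_onI)
      fix k l assume kl: "k \<in> {0..<a}" "l \<in> {0..<a}"
        "I +>\<^bsub>quad_order d\<^esub> of_int k = I +>\<^bsub>quad_order d\<^esub> of_int l"
      hence "a dvd k - l" using memI[of "k - l" 0] by (simp add: coset_eq)
      hence "k mod a = l mod a" by (simp add: mod_eq_dvd_iff)
      thus "k = l" using kl by simp
    qed
    show "(\<lambda>k. I +>\<^bsub>quad_order d\<^esub> of_int k) ` {0..<a} = carrier (quad_order d Quot I)"
    proof (intro equalityI subsetI)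
      fix X assume "X \<in> (\<lambda>k. I +>\<^bsub>quad_order d\<^esub> of_int k) ` {0..<a}"
      thus "X \<in> carrier (quad_order d Quot I)"
        using E_int in_carrier by (fastforce simp: FactRing_def A_RCOSETS_def')
    next
      fix X assume "X \<in> carrier (quad_order d Quot I)"
      then obtain x c where x: "X = I +>\<^bsub>quad_order d\<^esub> x" "(x, c) \<in> E"
        by (auto simp: FactRing_def A_RCOSETS_def' in_carrier)
      then obtain u v where uv: "x = of_int u + of_int v * ((of_int d + rd) / 2)" by (elim E_E)
      \<comment> \<open>Modulo \<open>I\<close>, \<theta> is congruent to -w.\<close>
      define k where "k = (u - v * w) mod a"
      have "a dvd (u - v * w) - k" unfolding k_def by (simp add: minus_mod_eq_mult_div)
      hence "a dvd (u - k) - v * w" by (simp add: algebra_simps)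
      hence "x - of_int k \<in> I" using memI[of "u - k" v] by (simp add: uv algebra_simps)
      hence "X = I +>\<^bsub>quad_order d\<^esub> of_int k" by (simp add: x coset_eq)
      moreover have "k \<in> {0..<a}" using a by (simp add: k_def)
      ultimately show "X \<in> (\<lambda>k. I +>\<^bsub>quad_order d\<^esub> of_int k) ` {0..<a}" by blast
    qed
  qed
  from bij_betw_same_card[OF this] show ?thesis by (simp add: ideal_norm_def)
qed

text \<open>The gcd condition on a, b, c makes the norm of a generator equal to a up to sign.
  Primitivity holds because the generator divides w + \<theta>, whose coefficient at \<theta> is
  1.\<close>

lemma principal_generator:
  assumes "reduced_ideal d I" "principalideal I (quad_order d)" "ideal_norm d I = n"
  obtains \<alpha> \<alpha>' where "(\<alpha>, \<alpha>') \<in> E" "\<bar>\<alpha> * \<alpha>'\<bar> = real n"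
    "\<And>p :: int. p > 1 \<Longrightarrow> (\<alpha> / of_int p, \<alpha>' / of_int p) \<notin> E"
proof -
  obtain a b where ab: "quad_irrational d a b"
      and I: "I = quad_lattice (of_int a) ((of_int b + rd) / 2)"
    using assms(1) by (auto simp: reduced_ideal_def reduced_quad_irrational_def)
  have a: "a > 0" and gcd1: "gcd a (gcd b ((b\<^sup>2 - d) div (4 * a))) = 1"
    and dvd: "4 * a dvd b\<^sup>2 - d"
    using ab by (simp_all add: quad_irrational_def)
  have n: "real n = of_int a" using ideal_norm_lattice[OF ab I] assms(3) a by simp
  define c where "c = (b\<^sup>2 - d) div (4 * a)"
  have c: "4 * a * c = b\<^sup>2 - d" unfolding c_def using dvd by simp
  define \<beta> \<beta>' where "\<beta> = (of_int b + rd) / 2" and "\<beta>' = (of_int b - rd) / 2"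
  obtain w where w: "\<beta> = of_int w + of_int 1 * ((of_int d + rd) / 2)"
    "\<beta>' = of_int w + of_int 1 * ((of_int d - rd) / 2)"
    using quad_irrational_theta[OF ab] unfolding \<beta>_def \<beta>'_def by metis
  have \<beta>E: "(\<beta>, \<beta>') \<in> E" using w by (rule E_I)
  have \<beta>_sum: "\<beta> + \<beta>' = of_int b" by (simp add: \<beta>_def \<beta>'_def field_simps)
  have "4 * (\<beta> * \<beta>') = of_int (b\<^sup>2 - d)"
    using rd_square by (simp add: \<beta>_def \<beta>'_def field_simps power2_eq_square)
  also have "\<dots> = 4 * of_int (a * c)" unfolding c[symmetric] by simp
  finally have \<beta>_prod: "\<beta> * \<beta>' = of_int (a * c)" by simp
  interpret R: cring "quad_order d" by (rule cring_order)
  obtain \<alpha> where "\<alpha> \<in> carrier (quad_order d)" "I = Idl\<^bsub>quad_order d\<^esub> {\<alpha>}"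
    using principalideal.generate[OF assms(2)] by blast
  hence I': "I = {x * \<alpha> | x. x \<in> carrier (quad_order d)}" "\<alpha> \<in> I"
    using R.cgenideal_eq_genideal[of \<alpha>] R.cgenideal_self[of \<alpha>] by (simp_all add: cgenideal_def)
  obtain \<alpha>' where \<alpha>E: "(\<alpha>, \<alpha>') \<in> E"
    using \<open>\<alpha> \<in> carrier _\<close> by (auto simp: in_carrier)
  have "of_int a = of_int 1 * of_int a + of_int 0 * \<beta>" "\<beta> = of_int 0 * of_int a + of_int 1 * \<beta>"
    by simp_all
  hence "of_int a \<in> I" "\<beta> \<in> I" unfolding I quad_lattice_def \<beta>_def by blast+
  then obtain \<gamma> \<delta> \<gamma>' \<delta>' where "of_int a = \<gamma> * \<alpha>" "\<beta> = \<delta> * \<alpha>"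
    and \<gamma>E: "(\<gamma>, \<gamma>') \<in> E" and \<delta>E: "(\<delta>, \<delta>') \<in> E"
    unfolding I' in_carrier by blast
  note eq = this(1,2)
  have eq': "of_int a = \<gamma>' * \<alpha>'" "\<beta>' = \<delta>' * \<alpha>'"
    using E_mult[OF \<gamma>E \<alpha>E] E_mult[OF \<delta>E \<alpha>E] E_int[of a] \<beta>E E_fst_unique unfolding eq by metis+
  obtain N where N: "\<alpha> * \<alpha>' = of_int N" using E_norm_int[OF \<alpha>E] by (auto elim: Ints_cases)
  \<comment> \<open>Writing a = \<gamma> \<alpha> and \<beta> = \<delta> \<alpha> shows that
    \<open>N\<close> divides a^2, a b and a c; coprimality of a, b, c then leaves \<open>N\<close>
    dividing a.\<close>
  have "N dvd a"
  proof -
    have dvdI: "N dvd k" if ks: "of_int k = s * (\<alpha> * \<alpha>')" "s \<in> \<int>" for k s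
    proof -
      obtain t where "s = of_int t" using ks(2) by (auto elim: Ints_cases)
      hence "real_of_int k = of_int (t * N)" using ks N by simp
      hence "k = t * N" by (simp only: of_int_eq_iff)
      thus ?thesis by simp
    qed
    have "of_int (a * a) = (\<gamma> * \<gamma>') * (\<alpha> * \<alpha>')"
      using eq(1) eq'(1) by (metis mult.assoc mult.left_commute of_int_mult)
    hence 1: "N dvd a * a" using dvdI E_norm_int[OF \<gamma>E] by blast
    have "of_int (a * c) = (\<delta> * \<delta>') * (\<alpha> * \<alpha>')"
      using \<beta>_prod eq(2) eq'(2) by (metis mult.assoc mult.left_commute)
    hence 2: "N dvd a * c" using dvdI E_norm_int[OF \<delta>E] by blast
    \<comment> \<open>\<open>s\<close> is the trace of \<gamma>' \<delta>, hence an integer.\<close>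
    define s where "s = \<gamma>' * \<delta> + \<gamma> * \<delta>'"
    have "(\<gamma>' * \<delta>, \<gamma> * \<delta>') \<in> E" using E_mult[OF E_swap[OF \<gamma>E] \<delta>E] .
    from E_add[OF this E_swap[OF this]] have "s \<in> \<int>"
      using E_eq_int by (simp add: s_def add.commute)
    have "of_int (a * b) = of_int a * \<beta> + of_int a * \<beta>'"
      using \<beta>_sum by (simp add: distrib_left[symmetric])
    also have "\<dots> = (\<gamma>' * \<alpha>') * (\<delta> * \<alpha>) + (\<gamma> * \<alpha>) * (\<delta>' * \<alpha>')"
      using eq eq' by metis
    also have "\<dots> = s * (\<alpha> * \<alpha>')" by (simp add: s_def algebra_simps)
    finally have 3: "N dvd a * b" using dvdI \<open>s \<in> \<int>\<close> by blast
    have "N dvd gcd (a * a) (gcd (a * b) (a * c))" using 1 2 3 by simp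
    also have "\<dots> = \<bar>a\<bar> * gcd a (gcd b c)"
      using a by (simp add: gcd_mult_distrib_int[symmetric])
    finally show ?thesis using gcd1 by (simp add: c_def)
  qed
  \<comment> \<open>The norm of x a + y \<beta> is a times the value of the form with coefficients
    a, b, c.\<close>
  moreover have "a dvd N"
  proof -
    obtain x y where xy: "\<alpha> = of_int x * of_int a + of_int y * \<beta>"
      using \<open>\<alpha> \<in> I\<close> unfolding I quad_lattice_def \<beta>_def by blast
    have "(of_int x * of_int a + of_int y * \<beta>, of_int x * of_int a + of_int y * \<beta>') \<in> E"
      by (intro E_add E_mult E_int \<beta>E)
    hence "\<alpha>' = of_int x * of_int a + of_int y * \<beta>'"
      using E_fst_unique \<alpha>E xy by metis
    hence "of_int N = of_int x * of_int x * of_int a * of_int a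
        + of_int x * of_int y * of_int a * (\<beta> + \<beta>') + of_int y * of_int y * (\<beta> * \<beta>')"
      unfolding N[symmetric] xy by (simp add: algebra_simps)
    also have "\<dots> = of_int (a * (x * x * a + x * y * b + y * y * c))"
      unfolding \<beta>_sum \<beta>_prod by (simp add: algebra_simps)
    finally have "N = a * (x * x * a + x * y * b + y * y * c)" by (simp only: of_int_eq_iff)
    thus ?thesis by simp
  qed
  ultimately have "\<bar>N\<bar> = a" using a by (metis abs_of_pos zdvd_antisym_abs)
  hence "\<bar>\<alpha> * \<alpha>'\<bar> = real n" unfolding N n by simp
  moreover have "(\<alpha> / of_int p, \<alpha>' / of_int p) \<notin> E" if p: "p > 1" for p :: int
  proof
    assume "(\<alpha> / of_int p, \<alpha>' / of_int p) \<in> E"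
    \<comment> \<open>Otherwise \<open>p\<close> would divide the coefficient 1 of \<theta> in
      \<beta> = \<delta> \<alpha>.\<close>
    from E_mult[OF \<delta>E this] obtain u v
      where "\<delta> * (\<alpha> / of_int p) = of_int u + of_int v * ((of_int d + rd) / 2)" by (elim E_E)
    hence "\<beta> = of_int (p * u) + of_int (p * v) * ((of_int d + rd) / 2)"
      unfolding eq using p by (simp add: field_simps)
    hence "1 = p * v" using coords_unique w(1) by metis
    thus False using p by (metis abs_of_pos abs_zmult_eq_1 less_irrefl zero_less_one order_less_trans abs_1)
  qed
  ultimately show ?thesis using \<alpha>E that by blast
qed

section \<open>Multiplicative independence and separation\<close>

lemma E_divide_iff:
  assumes "a = of_int u + of_int v * ((of_int d + rd) / 2)"
    "b = of_int u + of_int v * ((of_int d - rd) / 2)" "p \<noteq> 0"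
  shows "(a / of_int p, b / of_int p) \<in> E \<longleftrightarrow> p dvd u \<and> p dvd v"
proof
  assume "(a / of_int p, b / of_int p) \<in> E"
  then obtain u' v' where "a / of_int p = of_int u' + of_int v' * ((of_int d + rd) / 2)"
    by (elim E_E)
  hence "a = of_int (p * u') + of_int (p * v') * ((of_int d + rd) / 2)"
    using assms(3) by (simp add: field_simps)
  hence "u = p * u' \<and> v = p * v'" using coords_unique assms(1) by metis
  thus "p dvd u \<and> p dvd v" by simp
next
  assume "p dvd u \<and> p dvd v"
  then obtain u' v' where "u = p * u'" "v = p * v'" unfolding dvd_def by blast
  thus "(a / of_int p, b / of_int p) \<in> E"
    unfolding assms using assms(3) by (intro E_I[of _ u' v']) (simp_all add: field_simps)
qed

lemma E_divide_cancel:
  assumes "prime p" "\<not> p dvd c" "(a, b) \<in> E" "(of_int c * a / of_int p, of_int c * b / of_int p) \<in> E"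
  shows "(a / of_int p, b / of_int p) \<in> E"
proof -
  have p: "p \<noteq> 0" using assms(1) by auto
  obtain u v where uv: "a = of_int u + of_int v * ((of_int d + rd) / 2)"
    "b = of_int u + of_int v * ((of_int d - rd) / 2)"
    using assms(3) by (elim E_E)
  have "of_int c * a = of_int (c * u) + of_int (c * v) * ((of_int d + rd) / 2)"
    "of_int c * b = of_int (c * u) + of_int (c * v) * ((of_int d - rd) / 2)"
    unfolding uv by (simp_all add: algebra_simps)
  from E_divide_iff[OF this p] have "p dvd c * u" "p dvd c * v" using assms(4) by simp_all
  hence "p dvd u \<and> p dvd v" using assms(1,2) by (simp add: prime_dvd_mult_iff)
  thus ?thesis using E_divide_iff[OF uv p] by simp
qed

text \<open>Modulo \<open>p\<close> the characteristic equation reads \<open>a\<^sup>2 = T a\<close> with the trace \<open>T\<close>, so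
  \<open>a ^ Suc k = T ^ k * a\<close>.\<close>

lemma E_power_divide:
  assumes "prime p" "\<not> p dvd d" "(a, b) \<in> E" "a * b = of_int N" "p dvd N"
    "(a ^ Suc k / of_int p, b ^ Suc k / of_int p) \<in> E"
  shows "(a / of_int p, b / of_int p) \<in> E"
proof -
  have p: "p \<noteq> 0" using assms(1) by auto
  obtain u v where uv: "a = of_int u + of_int v * ((of_int d + rd) / 2)"
    "b = of_int u + of_int v * ((of_int d - rd) / 2)"
    using assms(3) by (elim E_E)
  define T where "T = 2 * u + d * v"
  have T: "a + b = of_int T" unfolding uv T_def by (simp add: field_simps)
  obtain N' where N': "N = p * N'" using assms(5) by (elim dvdE)
  have red: "((a ^ Suc k - of_int T ^ k * a) / of_int p, (b ^ Suc k - of_int T ^ k * b) / of_int p) \<in> E" for k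
  proof (induction k)
    case 0
    show ?case using E_int[of 0] by simp
  next
    case (Suc k)
    \<comment> \<open>This uses x^2 = T x - N with N divisible by p; the roles of x and y are left
      open so that it serves both conjugates.\<close>
    have step: "(x ^ Suc (Suc k) - of_int T ^ Suc k * x) / of_int p =
        x * ((x ^ Suc k - of_int T ^ k * x) / of_int p) + of_int (- (T ^ k * N'))"
      if "x * y = of_int N" "x + y = of_int T" for x y :: real
    proof -
      have "x ^ Suc (Suc k) - of_int T ^ Suc k * x =
          x * (x ^ Suc k - of_int T ^ k * x) - of_int T ^ k * (x * (of_int T - x))"
        by (simp add: algebra_simps)
      also have "of_int T - x = y" using that by simp
      also have "x * y = of_int p * of_int N'" using that N' by simp
      finally show ?thesis using p by (simp add: field_simps)
    qed
    from E_add[OF E_mult[OF assms(3) Suc] E_int[of "- (T ^ k * N')"]] show ?case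
      using step[of a b] step[of b a] assms(4) T by (simp only: mult.commute[of b a] add.commute[of b a])
  qed
  have "((a ^ Suc k / of_int p) + - ((a ^ Suc k - of_int T ^ k * a) / of_int p),
      (b ^ Suc k / of_int p) + - ((b ^ Suc k - of_int T ^ k * b) / of_int p)) \<in> E"
    by (intro E_add E_minus red assms(6))
  hence *: "(of_int (T ^ k) * a / of_int p, of_int (T ^ k) * b / of_int p) \<in> E"
    by (simp add: diff_divide_distrib)
  show ?thesis
  proof (cases "p dvd T")
    case False
    hence "\<not> p dvd T ^ k" using assms(1) prime_dvd_power by blast
    thus ?thesis using E_divide_cancel[OF assms(1) _ assms(3) *] by blast
  next
    case True
    have N: "N = u\<^sup>2 + d * u * v + q * v\<^sup>2"
      using E_norm_coords[OF uv] assms(4) by (simp only: of_int_eq_iff)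
    \<comment> \<open>The discriminant T^2 - 4 N of the characteristic polynomial equals d v^2. As
      \<open>p\<close> does not divide \<open>d\<close>, it divides v and then u, so
      \<open>a\<close> itself is divisible by \<open>p\<close>.\<close>
    have "4 * N = 4 * u\<^sup>2 + 4 * d * u * v + (4 * q) * v\<^sup>2" unfolding N by simp
    hence "T * T - 4 * N = d * v\<^sup>2"
      unfolding four_q T_def by (simp add: power2_eq_square algebra_simps)
    hence "p dvd d * v\<^sup>2" using True assms(5) by (metis dvd_diff dvd_mult)
    hence v: "p dvd v" using assms(1,2) by (metis prime_dvd_mult_iff prime_dvd_power)
    have "u\<^sup>2 = N - v * (d * u + q * v)" unfolding N by (simp add: power2_eq_square algebra_simps)
    hence "p dvd u\<^sup>2" using v assms(5) by simp
    hence "p dvd u" using assms(1) prime_dvd_power by blast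
    thus ?thesis using v E_divide_iff[OF uv p] by simp
  qed
qed

text \<open>The conjugate powers stand for division by \<alpha> j ^ f j, up to rational factors.
  Equality would make \<rho> times a power of \<alpha> i a rational integer divisible by
  \<open>p\<close>; as the norm of \<rho> is prime to \<open>p\<close>, already \<alpha> i would be
  divisible by \<open>p\<close>, against primitivity.\<close>

lemma monomial_irrational:
  fixes \<alpha> \<alpha>' :: "'i \<Rightarrow> real" and n e f :: "'i \<Rightarrow> nat"
  assumes S: "finite S" "i \<in> S"
    and \<alpha>: "\<And>j. j \<in> S \<Longrightarrow> (\<alpha> j, \<alpha>' j) \<in> E" "\<And>j. j \<in> S \<Longrightarrow> \<bar>\<alpha> j * \<alpha>' j\<bar> = real (n j)"
    and p: "prime p" "p dvd int (n i)" "\<not> p dvd d" "\<And>j. j \<in> S \<Longrightarrow> j \<noteq> i \<Longrightarrow> \<not> p dvd int (n j)"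
    and prim: "(\<alpha> i / of_int p, \<alpha>' i / of_int p) \<notin> E" and "n i > 0"
    and ef: "f i < e i" and \<epsilon>: "(\<epsilon>, \<epsilon>') \<in> E" "\<bar>\<epsilon> * \<epsilon>'\<bar> = 1"
  shows "\<epsilon> * (\<Prod>j\<in>S. \<alpha> j ^ e j * \<alpha>' j ^ f j) \<noteq> \<epsilon>' * (\<Prod>j\<in>S. \<alpha>' j ^ e j * \<alpha> j ^ f j)"
proof
  assume eq: "\<epsilon> * (\<Prod>j\<in>S. \<alpha> j ^ e j * \<alpha>' j ^ f j) = \<epsilon>' * (\<Prod>j\<in>S. \<alpha>' j ^ e j * \<alpha> j ^ f j)"
  define \<rho> \<rho>' where "\<rho> = \<epsilon> * (\<Prod>j\<in>S - {i}. \<alpha> j ^ e j * \<alpha>' j ^ f j)"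
    and "\<rho>' = \<epsilon>' * (\<Prod>j\<in>S - {i}. \<alpha>' j ^ e j * \<alpha> j ^ f j)"
  \<comment> \<open>The surplus exponent of \<alpha> i is \<open>Suc k\<close>, the form that
    \<open>E_power_divide\<close> expects.\<close>
  define k where "k = e i - f i - 1"
  have e: "e i = Suc k + f i" using ef by (simp add: k_def)
  have \<rho>E: "(\<rho>, \<rho>') \<in> E"
    unfolding \<rho>_def \<rho>'_def by (intro E_mult \<epsilon>(1) E_prod E_power \<alpha>(1) E_swap[OF \<alpha>(1)]) auto
  define M where "M = (\<Prod>j\<in>S - {i}. n j ^ (e j + f j))"
  have "\<rho> * \<rho>' = (\<epsilon> * \<epsilon>') *
      (\<Prod>j\<in>S - {i}. (\<alpha> j ^ e j * \<alpha>' j ^ f j) * (\<alpha>' j ^ e j * \<alpha> j ^ f j))"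
    unfolding \<rho>_def \<rho>'_def prod.distrib by simp
  also have "(\<Prod>j\<in>S - {i}. (\<alpha> j ^ e j * \<alpha>' j ^ f j) * (\<alpha>' j ^ e j * \<alpha> j ^ f j)) =
      (\<Prod>j\<in>S - {i}. (\<alpha> j * \<alpha>' j) ^ (e j + f j))"
    by (intro prod.cong) (simp_all add: power_add power_mult_distrib)
  finally have "\<bar>\<rho> * \<rho>'\<bar> = \<bar>\<epsilon> * \<epsilon>'\<bar> * (\<Prod>j\<in>S - {i}. \<bar>\<alpha> j * \<alpha>' j\<bar> ^ (e j + f j))"
    by (simp only: abs_mult[of "\<epsilon> * \<epsilon>'"] abs_prod power_abs)
  also have "\<dots> = real M" unfolding M_def using \<alpha>(2) \<epsilon>(2) by simp
  finally have \<rho>M: "\<bar>\<rho> * \<rho>'\<bar> = real M" .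
  obtain c where c: "\<rho> * \<rho>' = of_int c" using E_norm_int[OF \<rho>E] by (auto elim: Ints_cases)
  have "\<bar>c\<bar> = int M" using \<rho>M unfolding c by linarith
  moreover have "\<not> p dvd int M"
  proof
    assume "p dvd int M"
    hence "p dvd (\<Prod>j\<in>S - {i}. int (n j) ^ (e j + f j))" by (simp add: M_def)
    then obtain j where "j \<in> S - {i}" "p dvd int (n j) ^ (e j + f j)"
      using p(1) S(1) by (auto simp: prime_dvd_prod_iff)
    thus False using p(1,4) prime_dvd_power by blast
  qed
  ultimately have pc: "\<not> p dvd c" by (metis dvd_abs_iff)
  define g g' where "g = \<rho> * \<alpha> i ^ Suc k" and "g' = \<rho>' * \<alpha>' i ^ Suc k"
  have "g * (\<alpha> i * \<alpha>' i) ^ f i = \<epsilon> * (\<Prod>j\<in>S. \<alpha> j ^ e j * \<alpha>' j ^ f j)"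
    unfolding g_def \<rho>_def prod.remove[OF S] e power_add power_mult_distrib by simp
  moreover have "g' * (\<alpha> i * \<alpha>' i) ^ f i = \<epsilon>' * (\<Prod>j\<in>S. \<alpha>' j ^ e j * \<alpha> j ^ f j)"
    unfolding g'_def \<rho>'_def prod.remove[OF S] e power_add power_mult_distrib by simp
  ultimately have "g * (\<alpha> i * \<alpha>' i) ^ f i = g' * (\<alpha> i * \<alpha>' i) ^ f i" using eq by simp
  moreover have "\<alpha> i * \<alpha>' i \<noteq> 0" using \<alpha>(2)[OF S(2)] \<open>n i > 0\<close> by auto
  ultimately have "g = g'" by simp
  have gE: "(g, g') \<in> E" unfolding g_def g'_def by (intro E_mult \<rho>E E_power \<alpha> S)
  then obtain t where t: "g = of_int t" using E_eq_int \<open>g = g'\<close> by (auto elim: Ints_cases)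
  obtain N where N: "\<alpha> i * \<alpha>' i = of_int N" using E_norm_int[OF \<alpha>(1)[OF S(2)]] by (auto elim: Ints_cases)
  have "\<bar>real_of_int N\<bar> = real (n i)" using \<alpha>(2)[OF S(2)] N by simp
  hence "\<bar>N\<bar> = int (n i)" by linarith
  hence pN: "p dvd N" using p(2) by (metis dvd_abs_iff)
  \<comment> \<open>Taking norms shows that \<open>p\<close> divides t^2, hence t.\<close>
  have "real_of_int (t * t) = g * g'" using t \<open>g = g'\<close> by simp
  also have "\<dots> = of_int c * of_int N ^ Suc k"
    unfolding g_def g'_def c[symmetric] N[symmetric] by (simp add: power_mult_distrib mult_ac)
  also have "\<dots> = of_int (c * N ^ Suc k)" by simp
  finally have "t * t = c * N ^ Suc k" by (simp only: of_int_eq_iff)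
  hence "p dvd t * t" using pN by simp
  hence "p dvd t" using p(1) by (simp add: prime_dvd_mult_iff)
  then obtain t' where "t = p * t'" by (elim dvdE)
  hence t': "g = of_int p * of_int t'" using t by simp
  have p0: "p \<noteq> 0" using p(1) by auto
  \<comment> \<open>Multiplying g / p by \<rho>' replaces \<rho> by its norm \<open>c\<close>, which
    is prime to \<open>p\<close> and can be cancelled.\<close>
  have "(of_int t' * \<rho>', of_int t' * \<rho>) \<in> E" by (intro E_mult E_int E_swap[OF \<rho>E])
  moreover have t'': "of_int t' = g / of_int p" "of_int t' = g' / of_int p"
    using t' p0 \<open>g = g'\<close> by simp_all
  have "of_int t' * \<rho>' = of_int c * \<alpha> i ^ Suc k / of_int p"
    unfolding t''(1) g_def c[symmetric] by simp
  moreover have "of_int t' * \<rho> = of_int c * \<alpha>' i ^ Suc k / of_int p"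
    unfolding t''(2) g'_def c[symmetric] by simp
  ultimately have "(of_int c * \<alpha> i ^ Suc k / of_int p, of_int c * \<alpha>' i ^ Suc k / of_int p) \<in> E"
    by simp
  from E_divide_cancel[OF p(1) pc E_power[OF \<alpha>(1)[OF S(2)]] this]
  have "(\<alpha> i ^ Suc k / of_int p, \<alpha>' i ^ Suc k / of_int p) \<in> E" .
  from E_power_divide[OF p(1) p(3) \<alpha>(1)[OF S(2)] N pN this] prim show False by blast
qed

text \<open>The larger of the two absolute values is at least sqrt d / 2. Its ratio to the smaller
  one is its square divided by the absolute norm, hence at least (d / 4) / sqrt d.\<close>

lemma log_separation:
  assumes "(g, g') \<in> E" "g \<noteq> g'" "g \<noteq> 0" "\<bar>g * g'\<bar> \<le> rd"
  shows "ln (rd / 4) \<le> \<bar>ln (\<bar>g\<bar> / \<bar>g'\<bar>)\<bar>"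
proof -
  have *: "ln (rd / 4) \<le> ln (\<bar>x\<bar> / \<bar>y\<bar>)"
    if xy: "(x, y) \<in> E" "x \<noteq> y" "x \<noteq> 0" "\<bar>x * y\<bar> \<le> rd" "\<bar>y\<bar> \<le> \<bar>x\<bar>" for x y
  proof -
    have "y \<noteq> 0" using E_zero_iff xy by blast
    have "rd \<le> 2 * \<bar>x\<bar>" using E_diff[OF xy(1,2)] xy(5) by linarith
    hence "rd * rd \<le> (2 * \<bar>x\<bar>) * (2 * \<bar>x\<bar>)" using rd_gt_1 by (intro mult_mono) auto
    moreover have "rd * (\<bar>x\<bar> * \<bar>y\<bar>) \<le> rd * rd"
      using xy(4) rd_gt_1 by (intro mult_left_mono) (auto simp: abs_mult)
    ultimately have "\<bar>x\<bar> * (rd * \<bar>y\<bar>) \<le> \<bar>x\<bar> * (4 * \<bar>x\<bar>)" by (simp add: mult_ac)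
    hence "rd * \<bar>y\<bar> \<le> 4 * \<bar>x\<bar>" using xy(3) by simp
    hence "rd / 4 \<le> \<bar>x\<bar> / \<bar>y\<bar>" using \<open>y \<noteq> 0\<close> by (simp add: field_simps)
    thus ?thesis using rd_gt_1 by (intro ln_mono) auto
  qed
  show ?thesis
  proof (cases "\<bar>g'\<bar> \<le> \<bar>g\<bar>")
    case True
    thus ?thesis using *[of g g'] assms by linarith
  next
    case False
    have "g' \<noteq> 0" using E_zero_iff assms by blast
    hence "ln (\<bar>g\<bar> / \<bar>g'\<bar>) = - ln (\<bar>g'\<bar> / \<bar>g\<bar>)" using assms(3) by (simp add: ln_div)
    thus ?thesis using *[of g' g] E_swap[OF assms(1)] assms False \<open>g' \<noteq> 0\<close> by (simp add: mult.commute)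
  qed
qed

end

section \<open>Counting separated points and the regulator bound\<close>

text \<open>The points lie in different half-open cells of length \<delta>, and at most R / \<delta>
  + 1 cells are available.\<close>

lemma card_separated_le:
  fixes x :: "'a \<Rightarrow> real"
  assumes "finite F" "\<delta> > 0" "R > 0" "\<And>e. e \<in> F \<Longrightarrow> 0 \<le> x e \<and> x e < R"
    "\<And>e f. e \<in> F \<Longrightarrow> f \<in> F \<Longrightarrow> e \<noteq> f \<Longrightarrow> \<delta> \<le> \<bar>x e - x f\<bar>"
  shows "(real (card F) - 1) * \<delta> \<le> R"
proof -
  have floor_eq: "\<bar>u - v\<bar> < 1" if "\<lfloor>u\<rfloor> = \<lfloor>v\<rfloor>" for u v :: real
    using that floor_correct[of u] floor_correct[of v] unfolding that by linarith
  have "inj_on (\<lambda>e. \<lfloor>x e / \<delta>\<rfloor>) F"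
  proof (rule inj_onI, rule ccontr)
    fix e f assume ef: "e \<in> F" "f \<in> F" "\<lfloor>x e / \<delta>\<rfloor> = \<lfloor>x f / \<delta>\<rfloor>" "e \<noteq> f"
    have "\<bar>(x e - x f) / \<delta>\<bar> < 1" using floor_eq[OF ef(3)] by (simp only: diff_divide_distrib)
    hence "\<bar>x e - x f\<bar> / \<delta> < 1" using assms(2) by (simp only: abs_div_pos)
    hence "\<bar>x e - x f\<bar> < \<delta>" using assms(2) by simp
    thus False using assms(5)[OF ef(1,2,4)] by simp
  qed
  moreover have "(\<lambda>e. \<lfloor>x e / \<delta>\<rfloor>) ` F \<subseteq> {0..\<lfloor>R / \<delta>\<rfloor>}"
  proof (intro image_subsetI)
    fix e assume "e \<in> F"
    hence "0 \<le> x e / \<delta>" "x e / \<delta> \<le> R / \<delta>" using assms(2,4) by (auto simp: divide_right_mono less_imp_le)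
    thus "\<lfloor>x e / \<delta>\<rfloor> \<in> {0..\<lfloor>R / \<delta>\<rfloor>}" by (simp add: floor_mono)
  qed
  ultimately have "card F \<le> card {0..\<lfloor>R / \<delta>\<rfloor>}" by (intro card_inj_on_le) auto
  moreover have "0 \<le> \<lfloor>R / \<delta>\<rfloor>" using assms(2,3) by simp
  ultimately have "int (card F) \<le> \<lfloor>R / \<delta>\<rfloor> + 1" by (simp add: le_nat_iff)
  hence "real (card F) \<le> of_int (\<lfloor>R / \<delta>\<rfloor> + 1)" by (metis of_int_le_iff of_int_of_nat_eq)
  also have "\<dots> \<le> R / \<delta> + 1" by simp
  finally show ?thesis using assms(2) by (simp add: field_simps)
qed

context quad_disc
begin

text \<open>Outside the squarefree part s only the prime 2 can occur, and then s is not 1 modulo 4.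
  An odd d is impossible in that case: it is 1 modulo 4 and congruent to s, because odd squares are
  1 modulo 4.\<close>

lemma prime_dvd_fundamental_disc:
  assumes "prime p" "p dvd fundamental_disc d"
  shows "p dvd d"
proof -
  define s where "s = squarefree_part d"
  define t where "t = square_part d"
  have d: "d = s * t\<^sup>2" unfolding s_def t_def by (rule squarefree_decompose)
  show ?thesis
  proof (cases "p dvd s")
    case True
    thus ?thesis using d by simp
  next
    case False
    have F: "fundamental_disc d = (if s mod 4 = 1 then s else 4 * s)"
      by (simp add: fundamental_disc_def s_def Let_def)
    hence s: "s mod 4 \<noteq> 1" and "p dvd 4 * s" using assms(2) False by (auto split: if_splits)
    hence "p dvd 2 ^ 2" using False assms(1) by (simp add: prime_dvd_mult_iff)
    hence "p dvd 2" using assms(1) prime_dvd_power by blast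
    hence p: "p = 2" using assms(1) primes_dvd_imp_eq two_is_prime by blast
    have "even d"
    proof (rule ccontr)
      assume "odd d"
      moreover have "d mod 4 = 0 \<or> d mod 4 = 1" using disc by (simp add: quad_discriminant_def)
      ultimately have d1: "d mod 4 = 1" by presburger
      have "odd t" using \<open>odd d\<close> d by auto
      then obtain r where "t = 2 * r + 1" by (elim oddE)
      hence "t\<^sup>2 = 1 + 4 * (r * r + r)" by (simp add: power2_eq_square algebra_simps)
      hence "t\<^sup>2 mod 4 = 1" by presburger
      hence "d mod 4 = s mod 4" unfolding d by (metis mod_mult_right_eq mult.right_neutral)
      thus False using s d1 by simp
    qed
    thus ?thesis using p by simp
  qed
qed

text \<open>Monomials with exponents up to \<open>K\<close> are placed on a circle of length ln
  \<xi>. The bound \<open>AK\<close> keeps the product of two of their norms at most sqrt d, as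
  \<open>log_separation\<close> requires.\<close>

lemma regulator_lower_bound:
  fixes n :: "'i \<Rightarrow> nat" and A K :: nat and \<alpha> \<alpha>' :: "'i \<Rightarrow> real" and p :: "'i \<Rightarrow> int"
  assumes S: "finite S"
    and n: "\<And>i. i \<in> S \<Longrightarrow> n i > 0" "\<And>i. i \<in> S \<Longrightarrow> n i \<le> A" and "A \<ge> 1"
    and \<alpha>: "\<And>i. i \<in> S \<Longrightarrow> (\<alpha> i, \<alpha>' i) \<in> E" "\<And>i. i \<in> S \<Longrightarrow> \<bar>\<alpha> i * \<alpha>' i\<bar> = real (n i)"
    and p: "\<And>i. i \<in> S \<Longrightarrow> prime (p i)" "\<And>i. i \<in> S \<Longrightarrow> p i dvd int (n i)"
      "\<And>i. i \<in> S \<Longrightarrow> \<not> p i dvd d"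
      "\<And>i j. i \<in> S \<Longrightarrow> j \<in> S \<Longrightarrow> j \<noteq> i \<Longrightarrow> \<not> p i dvd int (n j)"
    and prim: "\<And>i. i \<in> S \<Longrightarrow> (\<alpha> i / of_int (p i), \<alpha>' i / of_int (p i)) \<notin> E"
    and AK: "real A ^ (2 * card S * K) \<le> rd" and "rd > 4"
  shows "(real ((K + 1) ^ card S) - 1) * (ln (rd / 4) / 2) \<le> ln (fundamental_unit d)"
proof -
  define \<xi> where "\<xi> = fundamental_unit d"
  define R where "R = ln \<xi>"
  have \<xi>: "\<xi> > 1" "\<xi> \<in> U" using fundamental_unit by (simp_all add: \<xi>_def)
  have R: "R > 0" using \<xi> by (simp add: R_def)
  define F where "F = S \<rightarrow>\<^sub>E {..K}"
  have card_F: "card F = (K + 1) ^ card S" and fin_F: "finite F"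
    unfolding F_def using S by (simp_all add: card_PiE finite_PiE)
  have nz: "\<alpha> i \<noteq> 0" "\<alpha>' i \<noteq> 0" if "i \<in> S" for i
    using \<alpha>(2)[OF that] n(1)[OF that] by auto
  define a where "a = (\<lambda>e. \<Prod>i\<in>S. \<alpha> i ^ e i)"
  define a' where "a' = (\<lambda>e. \<Prod>i\<in>S. \<alpha>' i ^ e i)"
  have a_nz: "a e \<noteq> 0" "a' e \<noteq> 0" for e
    using S nz by (simp_all add: a_def a'_def)
  have aE: "(a e, a' e) \<in> E" for e
    unfolding a_def a'_def by (intro E_prod E_power \<alpha>(1))
  have norm_a: "\<bar>a e * a' e\<bar> \<le> real A ^ (card S * K)" if "e \<in> F" for e
  proof -
    have "\<bar>a e * a' e\<bar> = (\<Prod>i\<in>S. \<bar>\<alpha> i * \<alpha>' i\<bar> ^ e i)"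
      unfolding a_def a'_def by (simp add: prod.distrib[symmetric] power_mult_distrib[symmetric] abs_prod power_abs)
    also have "\<dots> = (\<Prod>i\<in>S. real (n i) ^ e i)" using \<alpha>(2) by simp
    also have "\<dots> \<le> (\<Prod>i\<in>S. real A ^ K)"
    proof (intro prod_mono conjI)
      fix i assume i: "i \<in> S"
      have "e i \<le> K" using that i by (auto simp: F_def)
      have "real (n i) ^ e i \<le> real A ^ e i" using n(2)[OF i] by (intro power_mono) auto
      also have "\<dots> \<le> real A ^ K" using \<open>A \<ge> 1\<close> \<open>e i \<le> K\<close> by (intro power_increasing) auto
      finally show "real (n i) ^ e i \<le> real A ^ K" .
    qed auto
    also have "\<dots> = real A ^ (card S * K)" by (simp add: power_mult[symmetric] mult.commute)
    finally show ?thesis .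
  qed
  define L where "L = (\<lambda>e. ln (\<bar>a e\<bar> / \<bar>a' e\<bar>) / 2)"
  have two_L: "2 * L e = ln \<bar>a e\<bar> - ln \<bar>a' e\<bar>" for e
    using a_nz by (simp add: L_def ln_div)
  \<comment> \<open>Division with remainder selects the representative \<open>x\<close> of
    \<open>L\<close> in [0, R).\<close>
  define k where "k = (\<lambda>e. \<lfloor>L e / R\<rfloor>)"
  define x where "x = (\<lambda>e. L e - of_int (k e) * R)"
  have x_range: "0 \<le> x e \<and> x e < R" for e
  proof -
    have "of_int (k e) \<le> L e / R" "L e / R < of_int (k e) + 1" unfolding k_def by simp_all
    thus ?thesis using R by (simp add: x_def field_simps)
  qed
  have irr: "\<epsilon> * (a e * a' f) \<noteq> \<epsilon>' * (a' e * a f)"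
    if "(\<epsilon>, \<epsilon>') \<in> E" "\<bar>\<epsilon> * \<epsilon>'\<bar> = 1" "i \<in> S" "f i < e i" for \<epsilon> \<epsilon>' e f i
    using monomial_irrational[of S i \<alpha> \<alpha>' n "p i" f e \<epsilon> \<epsilon>'] that S \<alpha> p prim n
    by (simp add: a_def a'_def prod.distrib)
  have sep: "ln (rd / 4) / 2 \<le> \<bar>x e - x f\<bar>" if ef: "e \<in> F" "f \<in> F" "e \<noteq> f" for e f
  proof -
    \<comment> \<open>This unit compensates the two shifts, so that \<open>g\<close> below has
      position x e - x f.\<close>
    define \<epsilon> where "\<epsilon> = \<xi> powi (k f - k e)"
    have "\<epsilon> \<in> U" unfolding \<epsilon>_def by (rule U_powi[OF \<xi>(2)])
    then obtain \<epsilon>' where \<epsilon>: "(\<epsilon>, \<epsilon>') \<in> E" "\<bar>\<epsilon> * \<epsilon>'\<bar> = 1" by (auto simp: U_def)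
    have \<epsilon>_pos: "\<epsilon> > 0" using \<xi> by (simp add: \<epsilon>_def)
    have ln_\<epsilon>: "ln \<epsilon> = of_int (k f - k e) * R"
      using \<xi> powr_real_of_int'[of \<xi> "k f - k e"] unfolding \<epsilon>_def R_def
      by (metis less_trans less_eq_real_def ln_powr order_less_irrefl zero_less_one)
    \<comment> \<open>The conjugate a' f replaces 1 / a f: the two differ by a rational factor,
      which leaves the position unchanged, and the product stays in the order.\<close>
    define g g' where "g = \<epsilon> * (a e * a' f)" and "g' = \<epsilon>' * (a' e * a f)"
    have gE: "(g, g') \<in> E" unfolding g_def g'_def
      by (intro E_mult \<epsilon>(1) aE E_swap[OF aE])
    obtain i where i: "i \<in> S" "e i \<noteq> f i"
      using ef unfolding F_def by (metis PiE_ext)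
    have "g \<noteq> g'"
    \<comment> \<open>\<open>irr\<close> needs an index with the larger exponent on the unconjugated
      side; if it is on the other side, the conjugates are exchanged.\<close>
    proof (cases "f i < e i")
      case True
      thus ?thesis using irr[OF \<epsilon> i(1), of f e] by (simp add: g_def g'_def)
    next
      case False
      hence "e i < f i" using i(2) by simp
      with irr[of \<epsilon>' \<epsilon> i e f] E_swap[OF \<epsilon>(1)] \<epsilon>(2) i(1)
      show ?thesis by (simp add: g_def g'_def mult.commute mult.left_commute)
    qed
    moreover have "g \<noteq> 0" using \<epsilon>_pos a_nz by (simp add: g_def)
    moreover have "\<bar>g * g'\<bar> \<le> rd"
    proof -
      have "g * g' = (\<epsilon> * \<epsilon>') * ((a e * a' e) * (a f * a' f))" by (simp add: g_def g'_def mult_ac)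
      hence "\<bar>g * g'\<bar> = \<bar>a e * a' e\<bar> * \<bar>a f * a' f\<bar>"
        using \<epsilon>(2) by (simp only: abs_mult[of "\<epsilon> * \<epsilon>'"] abs_mult[of "a e * a' e"] mult_1)
      also have "\<dots> \<le> real A ^ (card S * K) * real A ^ (card S * K)"
        using norm_a ef by (intro mult_mono) auto
      also have "\<dots> = real A ^ (2 * card S * K)" 
        by (simp add: power_add[symmetric] mult_2 add_mult_distrib)
      finally show ?thesis using AK by simp
    qed
    ultimately have "ln (rd / 4) \<le> \<bar>ln (\<bar>g\<bar> / \<bar>g'\<bar>)\<bar>" using log_separation gE by blast
    also have "ln (\<bar>g\<bar> / \<bar>g'\<bar>) = 2 * (x e - x f)"
    proof -
      have "\<bar>\<epsilon>'\<bar> = 1 / \<epsilon>" using \<epsilon>(2) \<epsilon>_pos by (simp add: abs_mult field_simps)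
      hence "ln \<bar>\<epsilon>'\<bar> = - ln \<epsilon>" using \<epsilon>_pos by (simp add: ln_div)
      moreover have "\<epsilon>' \<noteq> 0" using \<epsilon>(2) by auto
      ultimately have "ln (\<bar>g\<bar> / \<bar>g'\<bar>) = 2 * ln \<epsilon> + (ln \<bar>a e\<bar> - ln \<bar>a' e\<bar>) - (ln \<bar>a f\<bar> - ln \<bar>a' f\<bar>)"
        using a_nz \<epsilon>_pos unfolding g_def g'_def by (simp add: abs_mult ln_div ln_mult)
      hence "ln (\<bar>g\<bar> / \<bar>g'\<bar>) = 2 * ln \<epsilon> + 2 * L e - 2 * L f"
        using two_L[of e] two_L[of f] by linarith
      thus ?thesis unfolding ln_\<epsilon> x_def by (simp add: algebra_simps del: ln_div)
    qed
    also have "\<bar>2 * (x e - x f)\<bar> = 2 * \<bar>x e - x f\<bar>" by (simp only: abs_mult)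
    finally show ?thesis by simp
  qed
  have "ln (rd / 4) / 2 > 0" using \<open>rd > 4\<close> by (simp add: ln_gt_zero del: ln_div)
  hence "(real (card F) - 1) * (ln (rd / 4) / 2) \<le> R"
    using card_separated_le[OF fin_F _ R] x_range sep by blast
  thus ?thesis unfolding card_F R_def \<xi>_def .
qed

end

text \<open>Half of \<open>X\<close> ^ m bounds (K + 1)^m - 1 from below, and ln (sqrt d) / 4 bounds
  ln (sqrt d / 4) / 2 from below, whence the factor 1 / 8.\<close>

lemma regulator_bound_large:
  fixes m :: nat and n :: "nat \<Rightarrow> nat" and A :: nat
  assumes "m \<ge> 1" and disc: "quad_discriminant d"
    and n_pos: "\<And>i. i \<in> {1..m} \<Longrightarrow> n i > 0"
    and n: "\<And>i. i \<in> {1..m} \<Longrightarrow> n i \<le> A" "A \<ge> 2"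
    and ideals: "\<And>i. i \<in> {1..m} \<Longrightarrow>
           \<exists>I. reduced_ideal d I \<and> principalideal I (quad_order d) \<and> ideal_norm d I = n i"
    and factors: "\<And>i. i \<in> {1..m} \<Longrightarrow> n i = n' i * n'' i \<and> n' i > 1 \<and>
                coprime (int (n' i)) d \<and> int (n'' i) dvd fundamental_disc d"
      "pairwise (\<lambda>i j. coprime (n' i) (n' j)) {1..m}"
    and large: "sqrt (of_int d) \<ge> 16" "sqrt (of_int d) \<ge> real A ^ (2 * m)"
  shows "ln (fundamental_unit d) \<ge> 1 / 8 * (1 / (2 * real m * ln (real A))) ^ m * ln (sqrt (of_int d)) ^ (m + 1)"
proof -
  interpret quad_disc d by unfold_locales (rule disc)
  have "\<exists>\<alpha> \<alpha>'. (\<alpha>, \<alpha>') \<in> E \<and> \<bar>\<alpha> * \<alpha>'\<bar> = real (n i) \<and>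
      (\<forall>p :: int. p > 1 \<longrightarrow> (\<alpha> / of_int p, \<alpha>' / of_int p) \<notin> E)" if "i \<in> {1..m}" for i
    using ideals[OF that] principal_generator by metis
  then obtain \<alpha> \<alpha>' where \<alpha>: "\<And>i. i \<in> {1..m} \<Longrightarrow> (\<alpha> i, \<alpha>' i) \<in> E"
    "\<And>i. i \<in> {1..m} \<Longrightarrow> \<bar>\<alpha> i * \<alpha>' i\<bar> = real (n i)"
    "\<And>i p. i \<in> {1..m} \<Longrightarrow> p > 1 \<Longrightarrow> (\<alpha> i / of_int p, \<alpha>' i / of_int p) \<notin> E"
    by metis
  have "\<exists>p. prime p \<and> p dvd n' i" if "i \<in> {1..m}" for i
    using factors(1)[OF that] prime_factor_nat by (metis less_irrefl)
  then obtain p where p: "\<And>i. i \<in> {1..m} \<Longrightarrow> prime (p i)" "\<And>i. i \<in> {1..m} \<Longrightarrow> p i dvd n' i"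
    by metis
  have p_d: "\<not> int (p i) dvd d" if "i \<in> {1..m}" for i
  proof
    assume "int (p i) dvd d"
    moreover have "int (p i) dvd int (n' i)" using p(2)[OF that] by simp
    ultimately have "is_unit (int (p i))" using factors(1)[OF that] coprime_common_divisor by blast
    thus False using p(1)[OF that] by simp
  qed
  \<comment> \<open>Pairwise coprimality keeps the prime away from n' j, and every prime divisor of
    n'' j divides \<open>d\<close>.\<close>
  have p_n: "\<not> int (p i) dvd int (n j)" if ij: "i \<in> {1..m}" "j \<in> {1..m}" "j \<noteq> i" for i j
  proof
    assume "int (p i) dvd int (n j)"
    hence "p i dvd n' j * n'' j" using factors(1)[OF ij(2)] by (simp only: of_nat_dvd_iff)
    hence "p i dvd n' j \<or> p i dvd n'' j" using p(1)[OF ij(1)] by (simp add: prime_dvd_mult_iff)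
    thus False
    proof
      assume "p i dvd n' j"
      moreover have "coprime (n' i) (n' j)" using factors(2) ij by (auto simp: pairwise_def)
      ultimately have "is_unit (p i)" using p(2)[OF ij(1)] coprime_common_divisor by blast
      thus False using p(1)[OF ij(1)] by simp
    next
      assume "p i dvd n'' j"
      hence "int (p i) dvd int (n'' j)" by simp
      hence "int (p i) dvd fundamental_disc d" using factors(1)[OF ij(2)] dvd_trans by blast
      hence "int (p i) dvd d" using prime_dvd_fundamental_disc p(1)[OF ij(1)] by simp
      thus False using p_d[OF ij(1)] by blast
    qed
  qed
  \<comment> \<open>\<open>X\<close> solves A^(2 m X) = sqrt d, so \<open>K\<close> is the largest
    exponent that \<open>AK\<close> permits; the second bound in \<open>large\<close> makes it at
    least 1.\<close>
  define X where "X = ln rd / (2 * real m * ln (real A))"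
  define K where "K = nat \<lfloor>X\<rfloor>"
  have lnA: "ln (real A) > 0" using n(2) by simp
  have den: "2 * real m * ln (real A) > 0" using lnA \<open>m \<ge> 1\<close> by simp
  have "ln (real A ^ (2 * m)) \<le> ln rd" using large n(2) by (intro ln_mono) auto
  hence "2 * real m * ln (real A) \<le> ln rd" using n(2) by (simp add: ln_realpow)
  hence X1: "X \<ge> 1" unfolding X_def using den by (simp add: le_divide_eq_1)
  have K: "real K \<le> X" "X \<le> real K + 1" "K \<ge> 1"
    using X1 unfolding K_def by (simp_all add: le_nat_iff)
  have "real A ^ (2 * m * K) = exp (real (2 * m * K) * ln (real A))"
    using n(2) by (simp only: exp_of_nat_mult) simp
  also have "real (2 * m * K) * ln (real A) = (2 * real m * ln (real A)) * real K" by simp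
  also have "\<dots> \<le> (2 * real m * ln (real A)) * X"
    using K(1) den by (intro mult_left_mono) auto
  also have "\<dots> = ln rd" unfolding X_def using den
    by (metis less_irrefl nonzero_mult_div_cancel_left times_divide_eq_right)
  also have "exp (ln rd) = rd" using d_gt_1 by simp
  finally have AK: "real A ^ (2 * card {1..m} * K) \<le> rd" by simp
  have "(real ((K + 1) ^ card {1..m}) - 1) * (ln (rd / 4) / 2) \<le> ln (fundamental_unit d)"
  proof (rule regulator_lower_bound[where p = "\<lambda>i. int (p i)" and n = n and A = A and \<alpha> = \<alpha> and \<alpha>' = \<alpha>'])
    fix i assume i: "i \<in> {1..m}"
    show "int (p i) dvd int (n i)" using p(2)[OF i] factors(1)[OF i] by simp
    show "prime (int (p i))" using p(1)[OF i] by simp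
    show "(\<alpha> i / of_int (int (p i)), \<alpha>' i / of_int (int (p i))) \<notin> E"
      using prime_gt_1_nat[OF p(1)[OF i]] by (intro \<alpha>(3) i) simp
  qed (use n_pos n \<alpha> p_d p_n AK large in auto)
  moreover have "(X ^ m / 2) * (ln rd / 4) \<le> (real ((K + 1) ^ card {1..m}) - 1) * (ln (rd / 4) / 2)"
  proof (intro mult_mono)
    have "X ^ m \<le> (real K + 1) ^ m" using X1 K by (intro power_mono) auto
    \<comment> \<open>Subtracting 1 therefore costs at most half of (K + 1)^m.\<close>
    moreover have "(real K + 1) ^ m \<ge> 2"
    proof -
      have "2 \<le> real K + 1" using K(3) by simp
      also have "\<dots> = (real K + 1) ^ 1" by simp
      also have "\<dots> \<le> (real K + 1) ^ m" using \<open>m \<ge> 1\<close> by (intro power_increasing) auto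
      finally show ?thesis .
    qed
    ultimately have "X ^ m / 2 \<le> (real K + 1) ^ m - 1" by linarith
    thus "X ^ m / 2 \<le> real ((K + 1) ^ card {1..m}) - 1" by (simp add: add.commute)
    \<comment> \<open>As 16 = 4^2, ln 4 is at most half of ln (sqrt d).\<close>
    have "ln (16 :: real) \<le> ln rd" using large by (intro ln_mono) auto
    moreover have "ln (16 :: real) = 2 * ln 4" using ln_realpow[of 4 2] by simp
    ultimately show "ln rd / 4 \<le> ln (rd / 4) / 2" using large by (simp add: ln_div)
    have "X ^ m \<ge> 0" using X1 by simp
    thus "0 \<le> real ((K + 1) ^ card {1..m}) - 1"
      using \<open>X ^ m / 2 \<le> real ((K + 1) ^ card {1..m}) - 1\<close> by linarith
    show "0 \<le> ln rd / 4" using ln_ge_zero[of rd] rd_gt_1 by linarith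
  qed
  moreover have "(X ^ m / 2) * (ln rd / 4) =
      1 / 8 * (1 / (2 * real m * ln (real A))) ^ m * ln rd ^ (m + 1)"
    unfolding X_def by (simp add: power_divide)
  ultimately show ?thesis by linarith
qed

text \<open>The condition \<open>n' i > 1\<close> supplies the primes dividing n' i and excludes
  families such as d = 4 (k^2 - 2) with 2 = 1 * 2. The factorisation may vary with \<open>d\<close>,
  but the constants depend only on \<open>m\<close> and \<open>n\<close>. The finitely many small
  discriminants are absorbed by lowering the constant.\<close>

theorem theorem1p3:
  fixes m :: nat and n :: "nat \<Rightarrow> nat" and D :: "int set"
  assumes "m \<ge> 1"
    and "\<And>i. i \<in> {1..m} \<Longrightarrow> n i \<ge> 2"
    and "infinite D"
    and "\<And>d. d \<in> D \<Longrightarrow> quad_discriminant d"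
    and "\<And>d i. d \<in> D \<Longrightarrow> i \<in> {1..m} \<Longrightarrow>
           \<exists>I. reduced_ideal d I \<and> principalideal I (quad_order d) \<and> ideal_norm d I = n i"
    and "\<And>d. d \<in> D \<Longrightarrow>
           \<exists>n' n'' :: nat \<Rightarrow> nat.
             (\<forall>i\<in>{1..m}. n i = n' i * n'' i \<and> n' i > 1 \<and>
                coprime (int (n' i)) d \<and>
                squarefree (n'' i) \<and> int (n'' i) dvd fundamental_disc d) \<and>
             pairwise (\<lambda>i j. coprime (n' i) (n' j)) {1..m}"
  shows "\<exists>c>0. \<forall>d\<in>D. ln (fundamental_unit d) \<ge> c * (ln (sqrt (of_int d))) ^ (m + 1)"
proof -
  define A where "A = Max (n ` {1..m})"
  have nA: "n i \<le> A" if "i \<in> {1..m}" for i unfolding A_def using that by (intro Max_ge) auto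
  have A2: "A \<ge> 2" using assms(2)[of 1] nA[of 1] assms(1) by simp
  \<comment> \<open>The threshold meets both size conditions of
    \<open>regulator_bound_large\<close>.\<close>
  define B where "B = max 16 (real A ^ (2 * m))"
  define c1 where "c1 = 1 / 8 * (1 / (2 * real m * ln (real A))) ^ m"
  have c1: "c1 > 0" unfolding c1_def using A2 assms(1) by simp
  have large: "ln (fundamental_unit d) \<ge> c1 * ln (sqrt (of_int d)) ^ (m + 1)"
    if d: "d \<in> D" "sqrt (of_int d) \<ge> B" for d
  proof -
    obtain n' n'' where fac: "\<forall>i\<in>{1..m}. n i = n' i * n'' i \<and> n' i > 1 \<and>
                coprime (int (n' i)) d \<and>
                squarefree (n'' i) \<and> int (n'' i) dvd fundamental_disc d"
       "pairwise (\<lambda>i j. coprime (n' i) (n' j)) {1..m}"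
      using assms(6)[OF d(1)] by blast
    show ?thesis unfolding c1_def
    proof (rule regulator_bound_large[where n = n and n' = n' and n'' = n''])
      fix i assume i: "i \<in> {1..m}"
      show "n i > 0" using assms(2)[OF i] by simp
      show "n i = n' i * n'' i \<and> n' i > 1 \<and> coprime (int (n' i)) d \<and> int (n'' i) dvd fundamental_disc d"
        using fac(1) i by blast
    qed (use assms(1,4,5) nA A2 d fac(2) in \<open>auto simp: B_def\<close>)
  qed
  define D0 where "D0 = {d \<in> D. sqrt (of_int d) < B}"
  define h where "h = (\<lambda>d. ln (fundamental_unit d) / ln (sqrt (of_int d)) ^ (m + 1))"
  have "D0 \<subseteq> {0..\<lceil>B\<^sup>2\<rceil>}"
  proof
    fix d assume d: "d \<in> D0"
    hence "d > 0" using assms(4) by (auto simp: D0_def quad_discriminant_def)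
    have "(sqrt (of_int d))\<^sup>2 \<le> B\<^sup>2" using d \<open>d > 0\<close> by (intro power_mono) (auto simp: D0_def)
    hence "real_of_int d \<le> B\<^sup>2" using \<open>d > 0\<close> by simp
    thus "d \<in> {0..\<lceil>B\<^sup>2\<rceil>}" using \<open>d > 0\<close> by (simp add: le_ceiling_iff)
  qed
  hence "finite D0" by (rule finite_subset) simp
  \<comment> \<open>The entry \<open>c1\<close> serves the large \<open>d\<close> and keeps the
    minimum defined if \<open>D0\<close> is empty; the ratios \<open>h\<close> serve the small ones
    and are positive since \<xi> > 1 and sqrt d > 1.\<close>
  define c where "c = Min (insert c1 (h ` D0))"
  have log_pos: "ln (sqrt (of_int d)) > 0" and unit_gt_1: "fundamental_unit d > 1" if "d \<in> D" for d
  proof -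
    interpret quad_disc d by unfold_locales (rule assms(4)[OF that])
    show "ln (sqrt (of_int d)) > 0" using rd_gt_1 by (rule ln_gt_zero)
    show "fundamental_unit d > 1" by (rule fundamental_unit)
  qed
  have "c > 0"
    unfolding c_def using \<open>finite D0\<close> c1 log_pos unit_gt_1
    by (auto simp: h_def D0_def intro!: divide_pos_pos zero_less_power ln_gt_zero)
  moreover have "c * ln (sqrt (of_int d)) ^ (m + 1) \<le> ln (fundamental_unit d)" if d: "d \<in> D" for d
  proof (cases "sqrt (of_int d) \<ge> B")
    case True
    have "c \<le> c1" unfolding c_def using \<open>finite D0\<close> by simp
    hence "c * ln (sqrt (of_int d)) ^ (m + 1) \<le> c1 * ln (sqrt (of_int d)) ^ (m + 1)"
      using log_pos[OF d] by (intro mult_right_mono) auto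
    thus ?thesis using large[OF d True] by linarith
  next
    case False
    hence "d \<in> D0" using d by (simp add: D0_def)
    hence "c \<le> h d" unfolding c_def using \<open>finite D0\<close> by simp
    hence "c * ln (sqrt (of_int d)) ^ (m + 1) \<le> h d * ln (sqrt (of_int d)) ^ (m + 1)"
      using log_pos[OF d] by (intro mult_right_mono) auto
    also have "\<dots> = ln (fundamental_unit d)" using log_pos[OF d] by (simp add: h_def)
    finally show ?thesis .
  qed
  ultimately show ?thesis by blast
qed

end
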